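(* Let $d\ge1$, let $\mathcal{K}_{\mathrm{logdet}}\subset\mathbb{R}\times\mathbb{R}\times\mathbb{S}^d$ be the log-determinant cone with barrier $F$ and let $G^\ast$ denote its conjugate gradient (all defined in the context). Let $(p,q,R)\in\operatorname{int}(\mathcal{K}_{\mathrm{logdet}}^\ast)$, let $R=U_R\operatorname{Diag}(\lambda_R)U_R^\top$ be the eigendecomposition of $R$, and let $$\bar\Omega:=d\cdot\omega\Bigl(\tfrac1d\Bigl(1+d-\tfrac{q}{p}+\sum_{i=1}^d\log\bigl(-\tfrac{\lambda_{R,i}}{p}\bigr)\Bigr)-\log(d)\Bigr),$$ where $\omega$ is the Wright omega function. Then the components of $G^\ast=G^\ast(p,q,R)$ are $$G^\ast_p=g^\ast_p(p,q,\lambda_R)=\frac{-d-2+\frac qp+2\bar\Omega}{p(1-\bar\Omega)},\qquad G^\ast_q=g^\ast_q(p,q,\lambda_R)=-p^{-1}(1-\bar\Omega)^{-1},$$ $$G^\ast_R=U_R\operatorname{Diag}(g^\ast_r(p,q,\lambda_R))U_R^\top=\frac{\bar\Omega}{1-\bar\Omega}R^{-1},$$ where $g^\ast$ is the conjugate gradient of the logarithm cone $\mathcal{K}_{\log}\subset\mathbb{R}\times\mathbb{R}\times\mathbb{R}^d$ with its barrier $f$.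
   Context: For a closed, convex, pointed, full-dimensional cone $\mathcal{K}$ in a finite-dimensional real inner product space, the dual cone is $\mathcal{K}^\ast=\{s:\langle w,s\rangle\ge 0\ \forall w\in\mathcal{K}\}$. Given a barrier function $f:\operatorname{int}(\mathcal{K})\to\mathbb{R}$, the conjugate barrier is $f^\ast(s)=\sup_{w\in\operatorname{int}(\mathcal{K})}\{-\langle s,w\rangle-f(w)\}$ for $s\in\operatorname{int}(\mathcal{K}^\ast)$, and the conjugate gradient $g^\ast$ is the gradient of $f^\ast$; equivalently $g^\ast(s)=-\operatorname{argsup}_{w\in\operatorname{int}(\mathcal{K})}\{-\langle s,w\rangle-f(w)\}$. The standard (trace, for matrices) inner product is used. Let $\varphi(w)=\sum_{i=1}^d\log w_i$ on $\mathbb{R}^d_{++}$. The logarithm cone is $\mathcal{K}_{\log}=\operatorname{cl}\{(u,v,w)\in\mathbb{R}\times\mathbb{R}_{++}\times\mathbb{R}^d_{++}:u\le v\varphi(w/v)\}$ with barrier $f(u,v,w)=-\log(v\varphi(w/v)-u)-\log(v)-\sum_{i=1}^d\log(w_i)$; its dual is $\operatorname{cl}\{(p,q,r)\in\mathbb{R}_{--}\times\mathbb{R}\times\mathbb{R}^d_{++}: q\ge p\sum_{i}\log(-r_i/p)+pd\}$, and the components of its conjugate gradient at a point $(p,q,r)$ are $g^\ast_p,g^\ast_q,g^\ast_r$. $\mathbb{S}^d$ denotes the symmetric $d\times d$ matrices and $\mathbb{S}^d_{++}$ the positive definite ones. The log-determinant cone is $$\mathcal{K}_{\mathrm{logdet}}=\operatorname{cl}\{(u,v,W)\in\mathbb{R}\times\mathbb{R}_{++}\times\mathbb{S}^d_{++}:u\le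 v\log\det(W/v)\},$$ with dual $$\mathcal{K}_{\mathrm{logdet}}^\ast=\operatorname{cl}\{(p,q,R)\in\mathbb{R}_{--}\times\mathbb{R}\times\mathbb{S}^d_{++}:q\ge p\log\det(-R/p)+pd\},$$ and barrier $F(u,v,W)=f(u,v,\lambda_W)$, where $\lambda_W\in\mathbb{R}^d$ is the vector of eigenvalues of $W$ (so $F(u,v,W)=-\log(v\log\det(W/v)-u)-\log v-\log\det W$). In the eigendecomposition $R=U_R\operatorname{Diag}(\lambda_R)U_R^\top$, $U_R$ is orthogonal and $\lambda_R=(\lambda_{R,1},\dots,\lambda_{R,d})$ is the vector of eigenvalues. For real $\beta$, $\omega(\beta)$ is the unique positive real with $\omega(\beta)+\log(\omega(\beta))=\beta$. *)

theory Defs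
  imports "HOL-Analysis.Analysis"
begin

section \<open>Symmetric matrices with the trace inner product\<close>

typedef 'd sym_mat = "{A :: real^'d^'d. transpose A = A}"
  morphisms mat_of_sym sym_of_mat
  by (rule exI[of _ "mat 1"]) (simp add: transpose_mat)

setup_lifting type_definition_sym_mat

lemma subspace_symmetric: "subspace {A :: real^'d^'d. transpose A = A}"
  by (auto simp: subspace_def transpose_def vec_eq_iff)

instantiation sym_mat :: (finite) real_vector
begin

lift_definition zero_sym_mat :: "'a sym_mat" is 0
  by (simp add: transpose_def vec_eq_iff)

lift_definition plus_sym_mat :: "'a sym_mat \<Rightarrow> 'a sym_mat \<Rightarrow> 'a sym_mat" is "(+)"
  by (simp add: transpose_def vec_eq_iff)

lift_definition minus_sym_mat :: "'a sym_mat \<Rightarrow> 'a sym_mat \<Rightarrow> 'a sym_mat" is "(-)"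
  by (simp add: transpose_def vec_eq_iff)

lift_definition uminus_sym_mat :: "'a sym_mat \<Rightarrow> 'a sym_mat" is uminus
  by (simp add: transpose_def vec_eq_iff)

lift_definition scaleR_sym_mat :: "real \<Rightarrow> 'a sym_mat \<Rightarrow> 'a sym_mat" is scaleR
  by (simp add: transpose_def vec_eq_iff)

instance
  by standard (transfer; simp add: algebra_simps)+

end

lemma trace_matrix_mult_symmetric:
  fixes A B :: "real^'d^'d"
  assumes "transpose B = B"
  shows "trace (A ** B) = A \<bullet> B"
proof -
  have "B $ k $ i = B $ i $ k" for i k
    using assms by (metis transpose_def vec_lambda_beta)
  then show ?thesis
    by (simp add: trace_def matrix_matrix_mult_def inner_vec_def)
qed

instantiation sym_mat :: (finite) real_inner
begin

lift_definition inner_sym_mat :: "'a sym_mat \<Rightarrow> 'a sym_mat \<Rightarrow> real"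
  is "\<lambda>A B. trace (A ** B)" .

definition norm_sym_mat :: "'a sym_mat \<Rightarrow> real"
  where "norm_sym_mat A = sqrt (A \<bullet> A)"

definition sgn_sym_mat :: "'a sym_mat \<Rightarrow> 'a sym_mat"
  where "sgn_sym_mat A = A /\<^sub>R norm A"

definition dist_sym_mat :: "'a sym_mat \<Rightarrow> 'a sym_mat \<Rightarrow> real"
  where "dist_sym_mat A B = norm (A - B)"

definition uniformity_sym_mat :: "('a sym_mat \<times> 'a sym_mat) filter"
  where "uniformity_sym_mat = (INF e\<in>{0 <..}. principal {(x, y). dist x y < e})"

definition open_sym_mat :: "'a sym_mat set \<Rightarrow> bool"
  where "open_sym_mat S \<longleftrightarrow>
    (\<forall>x\<in>S. \<forall>\<^sub>F (x', y) in uniformity. x' = x \<longrightarrow> y \<in> S)"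

instance
proof
  fix x y z :: "'a sym_mat" and r :: real
  show "x \<bullet> y = y \<bullet> x"
    by transfer (simp add: trace_matrix_mult_symmetric inner_commute)
  show "(x + y) \<bullet> z = x \<bullet> z + y \<bullet> z"
    by transfer (simp add: trace_matrix_mult_symmetric inner_add_left)
  show "(r *\<^sub>R x) \<bullet> y = r * (x \<bullet> y)"
    by transfer (simp add: trace_matrix_mult_symmetric)
  show "0 \<le> x \<bullet> x"
    by transfer (simp add: trace_matrix_mult_symmetric)
  show "x \<bullet> x = 0 \<longleftrightarrow> x = 0"
    by transfer (simp add: trace_matrix_mult_symmetric)
qed (simp_all add: norm_sym_mat_def sgn_sym_mat_def dist_sym_mat_def
      uniformity_sym_mat_def open_sym_mat_def)

end

lemma inner_mat_of_sym: "A \<bullet> B = mat_of_sym A \<bullet> mat_of_sym B"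
  using mat_of_sym[of B]
  by (simp add: inner_sym_mat.rep_eq trace_matrix_mult_symmetric)

lemma sym_mat_orthonormal_basis:
  "\<exists>B :: 'd::finite sym_mat set. B \<noteq> {} \<and> finite B \<and>
     (\<forall>u\<in>B. \<forall>v\<in>B. u \<bullet> v = (if u = v then 1 else 0)) \<and>
     (\<forall>x. (\<forall>u\<in>B. x \<bullet> u = 0) \<longleftrightarrow> x = 0)"
proof -
  let ?S = "{A :: real^'d^'d. transpose A = A}"
  obtain B where B: "B \<subseteq> ?S" "pairwise orthogonal B" "\<And>x. x \<in> B \<Longrightarrow> norm x = 1"
      "independent B" "span B = ?S"
    by (rule orthonormal_basis_subspace[OF subspace_symmetric]) blast
  have fin: "finite B"
    using B(4) by (rule independent_imp_finite)
  have inv: "mat_of_sym (sym_of_mat A) = A" if "A \<in> B" for A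
    using that B(1) by (intro sym_of_mat_inverse) auto
  have "B \<noteq> {}"
  proof
    assume "B = {}"
    then have "?S = {0}" using B(5) by simp
    moreover have "mat 1 \<in> ?S" by (simp add: transpose_mat)
    ultimately have "(mat 1 :: real^'d^'d) = 0" by blast
    then have "(mat 1 :: real^'d^'d) $ i $ i = 0" for i
      by simp
    then show False by (simp add: mat_def)
  qed
  moreover have "u \<bullet> v = (if u = v then 1 else 0)"
    if uv: "u \<in> sym_of_mat ` B" "v \<in> sym_of_mat ` B" for u v
  proof -
    obtain a b where ab: "a \<in> B" "b \<in> B" "u = sym_of_mat a" "v = sym_of_mat b"
      using uv by auto
    have "u = v \<longleftrightarrow> a = b" using ab inv by metis
    moreover have "a \<bullet> b = (if a = b then 1 else 0)"
      using B(2) B(3)[OF ab(1)] ab(1,2)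
      by (auto simp: pairwise_def orthogonal_def norm_eq_1)
    ultimately show ?thesis using ab inv by (simp add: inner_mat_of_sym)
  qed
  moreover have "x = 0" if x: "\<forall>u\<in>sym_of_mat ` B. x \<bullet> u = 0" for x
  proof -
    have "\<forall>b\<in>B. orthogonal (mat_of_sym x) b"
      using x inv by (simp add: inner_mat_of_sym orthogonal_def)
    moreover have "mat_of_sym x \<in> span B"
      using mat_of_sym[of x] B(5) by simp
    ultimately have "orthogonal (mat_of_sym x) (mat_of_sym x)"
      using orthogonal_to_span by blast
    then have "mat_of_sym x \<bullet> mat_of_sym x = 0"
      by (simp only: orthogonal_def)
    then show ?thesis
      by (simp only: inner_mat_of_sym[symmetric] inner_eq_zero_iff)
  qed
  ultimately show ?thesis
    using fin by (intro exI[of _ "sym_of_mat ` B"]) auto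
qed

instantiation sym_mat :: (finite) euclidean_space
begin

definition Basis_sym_mat :: "'a sym_mat set"
  where "Basis_sym_mat = (SOME B. B \<noteq> {} \<and> finite B \<and>
     (\<forall>u\<in>B. \<forall>v\<in>B. u \<bullet> v = (if u = v then 1 else 0)) \<and>
     (\<forall>x. (\<forall>u\<in>B. x \<bullet> u = 0) \<longleftrightarrow> x = 0))"

instance
proof -
  have "(Basis :: 'a sym_mat set) \<noteq> {} \<and> finite (Basis :: 'a sym_mat set) \<and>
     (\<forall>u\<in>(Basis :: 'a sym_mat set). \<forall>v\<in>Basis. u \<bullet> v = (if u = v then 1 else 0)) \<and>
     (\<forall>x :: 'a sym_mat. (\<forall>u\<in>Basis. x \<bullet> u = 0) \<longleftrightarrow> x = 0)"
    unfolding Basis_sym_mat_def by (rule someI_ex[OF sym_mat_orthonormal_basis])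
  then show "OFCLASS('a sym_mat, euclidean_space_class)"
    by intro_classes auto
qed

end

definition pos_def :: "'d::finite sym_mat \<Rightarrow> bool"
  where "pos_def W \<longleftrightarrow> (\<forall>x. x \<noteq> 0 \<longrightarrow> 0 < x \<bullet> (mat_of_sym W *v x))"

definition Diag :: "real^'d \<Rightarrow> real^'d^'d"
  where "Diag l = (\<chi> i j. if i = j then l $ i else 0)"

definition eigendecomposition :: "'d::finite sym_mat \<Rightarrow> real^'d^'d \<Rightarrow> real^'d \<Rightarrow> bool"
  where "eigendecomposition W U l \<longleftrightarrow>
    orthogonal_matrix U \<and> mat_of_sym W = U ** Diag l ** transpose U"

text \<open>The vector of eigenvalues, counted with multiplicity, is determined only up to a
  permutation of the coordinates; one ordering is chosen arbitrarily. It is used only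
  inside the permutation-invariant function \<open>log_barrier\<close> below.\<close>

definition eigenvalues :: "'d::finite sym_mat \<Rightarrow> real^'d"
  where "eigenvalues W = (SOME l. \<exists>U. eigendecomposition W U l)"


section \<open>Dual cones and conjugate barriers\<close>

definition dual_cone :: "'a::euclidean_space set \<Rightarrow> 'a set"
  where "dual_cone K = {s. \<forall>w\<in>K. 0 \<le> w \<bullet> s}"

definition conjugate_barrier :: "'a::euclidean_space set \<Rightarrow> ('a \<Rightarrow> real) \<Rightarrow> 'a \<Rightarrow> real"
  where "conjugate_barrier K f s = (SUP w\<in>interior K. - (s \<bullet> w) - f w)"

definition conjugate_gradient :: "'a::euclidean_space set \<Rightarrow> ('a \<Rightarrow> real) \<Rightarrow> 'a \<Rightarrow> 'a"
  where "conjugate_gradient K f s = (THE g. GDERIV (conjugate_barrier K f) s :> g)"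

text \<open>The real-valued \<open>Sup\<close> and the operator \<open>THE\<close> are total, so the following predicate
  records that the two definitions above have their intended meaning at \<open>s\<close>: the point is in
  the interior of the dual cone, the conjugate barrier is finite on that interior (hence near
  \<open>s\<close>), and it is differentiable at \<open>s\<close>.\<close>

definition conjugate_gradient_exists ::
    "'a::euclidean_space set \<Rightarrow> ('a \<Rightarrow> real) \<Rightarrow> 'a \<Rightarrow> bool"
  where "conjugate_gradient_exists K f s \<longleftrightarrow>
    s \<in> interior (dual_cone K) \<and>
    (\<forall>t\<in>interior (dual_cone K). bdd_above ((\<lambda>w. - (t \<bullet> w) - f w) ` interior K)) \<and>
    (\<exists>g. GDERIV (conjugate_barrier K f) s :> g)"


section \<open>The logarithm cone and the log-determinant cone\<close>

definition sum_log :: "real^'d \<Rightarrow> real"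
  where "sum_log w = (\<Sum>i\<in>UNIV. ln (w $ i))"

definition log_cone :: "(real \<times> real \<times> (real^'d)) set"
  where "log_cone = closure
    {(u, v, w). 0 < v \<and> (\<forall>i. 0 < w $ i) \<and> u \<le> v * sum_log (w /\<^sub>R v)}"

definition log_barrier :: "real \<times> real \<times> (real^'d) \<Rightarrow> real"
  where "log_barrier = (\<lambda>(u, v, w).
    - ln (v * sum_log (w /\<^sub>R v) - u) - ln v - (\<Sum>i\<in>UNIV. ln (w $ i)))"

definition logdet_cone :: "(real \<times> real \<times> 'd::finite sym_mat) set"
  where "logdet_cone = closure
    {(u, v, W). 0 < v \<and> pos_def W \<and> u \<le> v * ln (det (mat_of_sym (W /\<^sub>R v)))}"

definition logdet_barrier :: "real \<times> real \<times> 'd::finite sym_mat \<Rightarrow> real"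
  where "logdet_barrier = (\<lambda>(u, v, W). log_barrier (u, v, eigenvalues W))"


section \<open>The Wright omega function on the reals\<close>

definition wright_omega :: "real \<Rightarrow> real"
  where "wright_omega b = (THE x. 0 < x \<and> x + ln x = b)"

end

theory Submission
  imports Defs
begin

text \<open>
  Both cones are instances of one construction. On the positive orthant take
  \<open>\<phi> w = (\<Sum>i. ln (w $ i))\<close> with entrywise inversion \<open>\<iota>\<close>, on the positive definite
  matrices take \<open>\<phi> W = ln (det W)\<close> with matrix inversion \<open>\<iota>\<close>. In either case \<open>\<phi>\<close> is
  logarithmically homogeneous of degree \<open>d\<close> and is essentially its own concave conjugate:
  \<open>\<phi> w + \<phi> s \<le> w \<bullet> s - d\<close> for all \<open>w\<close> and \<open>s\<close>, with equality for \<open>s = \<iota> w\<close>. For vectors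
  this is the inequality \<open>ln x \<le> x - 1\<close> summed over the entries of the product; for matrices
  \<open>ln_det_fenchel\<close> applies it to the eigenvalues of \<open>C\<^sup>T W C\<close>, where \<open>S = C C\<^sup>T\<close>. The
  locale \<open>log_homogeneous\<close> collects these properties, and everything about the conjugate
  gradient is proved there once.

  The Fenchel inequality exhibits the hypograph of \<open>v * \<phi> (w / v)\<close> as an intersection of
  halfspaces. This gives its convexity, the interior of its closure, and the interior of the
  dual cone, all without differentiating \<open>\<phi>\<close>. The supremum defining the conjugate barrier is
  attained at a point that is found by solving the stationarity equations, which reduce to the
  scalar equation \<open>\<Omega> + d * ln \<Omega> = 1 + d - q / p + \<phi> (- r / p)\<close>; its solution is a
  rescaled value of the Wright omega function. That the point is a global maximizer follows by
  adding four tangent inequalities, one for each concave term of the objective (lemma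
  \<open>maximizer\<close> in the locale).

  Differentiability needs no calculus either. If a supremum of affine functions is attained by
  one that depends continuously on the argument, it is differentiable, and its gradient is the
  slope of the attaining affine function (\<open>GDERIV_sup_of_affine\<close>). Hence the conjugate gradient is minus
  the maximizer. The spectral theorem connects the two instances: since
  \<open>ln (det R)\<close> is the sum of the logarithms of the eigenvalues, the two scalar equations
  coincide, so the two gradients share the same \<open>\<Omega>\<close>.
\<close>


section \<open>The Wright omega function\<close>

lemma wright_omega_exists: "\<exists>x>0. x + ln x = (b::real)"
proof -
  \<comment> \<open>The endpoints work because \<open>ln ?l = b - ?u\<close> and \<open>?l \<le> ?u\<close>, and because \<open>ln ?u = b\<close>.\<close>
  let ?l = "exp (b - exp b)" and ?u = "exp b"
  have "?l \<le> ?u" by simp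
  moreover have "?l + ln ?l \<le> b" by (simp add: exp_le_cancel_iff)
  moreover have "b \<le> ?u + ln ?u" by simp
  moreover have "continuous_on {?l..?u} (\<lambda>x. x + ln x)"
    by (intro continuous_intros) (auto intro: order.strict_trans2[OF exp_gt_zero])
  ultimately obtain x where "?l \<le> x" "x \<le> ?u" "x + ln x = b"
    using IVT'[of "\<lambda>x. x + ln x" ?l b ?u] by blast
  moreover have "0 < x" using \<open>?l \<le> x\<close> by (rule order.strict_trans2[OF exp_gt_zero])
  ultimately show ?thesis by blast
qed

text \<open>Both summands of \<open>x + ln x\<close> increase, so its inverse function, the Wright omega
  function, is well defined and 1-Lipschitz.\<close>

lemma id_plus_ln_expanding:
  fixes x y :: real
  assumes "0 < x" "0 < y"
  shows "\<bar>x - y\<bar> \<le> \<bar>(x + ln x) - (y + ln y)\<bar>"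
proof (cases "x \<le> y")
  case True
  then have "ln x \<le> ln y" using assms by simp
  with True show ?thesis by simp
next
  case False
  then have "ln y \<le> ln x" using assms by simp
  with False show ?thesis by simp
qed

lemma wright_omega: "0 < wright_omega b" "wright_omega b + ln (wright_omega b) = b"
proof -
  have "\<exists>!x. 0 < x \<and> x + ln x = b"
  proof (rule ex_ex1I)
    show "\<exists>x. 0 < x \<and> x + ln x = b" using wright_omega_exists by blast
    show "x = y" if "0 < x \<and> x + ln x = b" "0 < y \<and> y + ln y = b" for x y
      using id_plus_ln_expanding[of x y] that by simp
  qed
  from theI'[OF this] show "0 < wright_omega b" "wright_omega b + ln (wright_omega b) = b"
    by (simp_all add: wright_omega_def)
qed

lemma continuous_on_wright_omega: "continuous_on A wright_omega"
proof (rule lipschitz_on_continuous_on)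
  show "1-lipschitz_on A wright_omega"
    using id_plus_ln_expanding[OF wright_omega(1) wright_omega(1)]
    by (intro lipschitz_onI) (simp_all add: wright_omega dist_real_def)
qed


section \<open>Gradients of suprema of affine functions\<close>

text \<open>Comparing the two affine functions that are maximal at \<open>s\<close> and at \<open>t\<close> traps
  \<open>F t - F s + (t - s) \<bullet> m s\<close> between \<open>0\<close> and \<open>- (t - s) \<bullet> (m t - m s)\<close>, and the latter
  is of smaller order than \<open>t - s\<close> when \<open>m\<close> is continuous.\<close>

lemma GDERIV_sup_of_affine:
  fixes F :: "'a::euclidean_space \<Rightarrow> real" and m :: "'a \<Rightarrow> 'a"
  assumes D: "open D" "s \<in> D" and m: "continuous_on D m" "\<And>t. t \<in> D \<Longrightarrow> m t \<in> A"
    and le: "\<And>t w. t \<in> D \<Longrightarrow> w \<in> A \<Longrightarrow> - (t \<bullet> w) - f w \<le> F t"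
    and eq: "\<And>t. t \<in> D \<Longrightarrow> F t = - (t \<bullet> m t) - f (m t)"
  shows "GDERIV F s :> - m s"
  unfolding gderiv_def has_derivative_at_alt
proof (intro conjI allI impI)
  show "bounded_linear (\<lambda>h. h \<bullet> - m s)" by (rule bounded_linear_inner_left)
  fix e :: real assume "0 < e"
  have "isCont m s" using m(1) D by (simp add: continuous_on_eq_continuous_at)
  then obtain e1 where e1: "0 < e1" "\<And>t. dist t s < e1 \<Longrightarrow> dist (m t) (m s) < e"
    using \<open>0 < e\<close> unfolding continuous_at_eps_delta by metis
  obtain e2 where e2: "0 < e2" "ball s e2 \<subseteq> D" using D open_contains_ball by blast
  show "\<exists>d>0. \<forall>t. norm (t - s) < d \<longrightarrow>
      norm (F t - F s - (t - s) \<bullet> - m s) \<le> e * norm (t - s)"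
  proof (intro exI conjI allI impI)
    show "0 < min e1 e2" using e1 e2 by simp
    fix t assume "norm (t - s) < min e1 e2"
    then have t: "t \<in> D" "norm (m t - m s) \<le> e"
      using e1(2)[of t] e2 by (auto simp: dist_norm norm_minus_commute intro: less_imp_le)
    have "- (t \<bullet> m s) - f (m s) \<le> F t" "- (s \<bullet> m t) - f (m t) \<le> F s"
      using le t D m(2) by auto
    then have lo: "0 \<le> F t - F s - (t - s) \<bullet> - m s"
      and hi: "F t - F s - (t - s) \<bullet> - m s \<le> - ((t - s) \<bullet> (m t - m s))"
      using eq[OF t(1)] eq[OF D(2)] by (simp_all add: algebra_simps)
    have "\<bar>(t - s) \<bullet> (m t - m s)\<bar> \<le> norm (t - s) * norm (m t - m s)"
      by (rule Cauchy_Schwarz_ineq2)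
    also have "\<dots> \<le> norm (t - s) * e" using t by (intro mult_left_mono) auto
    finally show "norm (F t - F s - (t - s) \<bullet> - m s) \<le> e * norm (t - s)"
      using lo hi by (simp add: mult.commute)
  qed
qed

lemma GDERIV_unique:
  assumes "GDERIV F s :> a" "GDERIV F s :> b"
  shows "a = b"
proof -
  have "(\<lambda>h. h \<bullet> a) = (\<lambda>h. h \<bullet> b)"
    using assms unfolding gderiv_def by (rule has_derivative_unique)
  then have "(a - b) \<bullet> a = (a - b) \<bullet> b" by (rule fun_cong)
  then have "(a - b) \<bullet> (a - b) = 0" by (simp add: algebra_simps)
  then show ?thesis by simp
qed


section \<open>Logarithmically homogeneous, self-conjugate functions\<close>

text \<open>The open convex cone \<open>P\<close> plays the role of the positive orthant or of the positive
  definite matrices. Assumption \<open>dual_P\<close> says in the form most convenient to verify that the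
  dual of \<open>P\<close> lies in the closure of \<open>P\<close>. Assumption \<open>fenchel\<close> together with
  \<open>phi_iota\<close> and \<open>inner_iota\<close> says that the minimum of \<open>w \<bullet> s - d - \<phi> s\<close> over \<open>s \<in> P\<close> is
  \<open>\<phi> w\<close>, attained at \<open>\<iota> w\<close>; so \<open>\<iota>\<close> is the gradient of \<open>\<phi>\<close>.\<close>

locale log_homogeneous =
  fixes P :: "'a::euclidean_space set" and \<phi> :: "'a \<Rightarrow> real" and \<iota> :: "'a \<Rightarrow> 'a" and d :: real
  assumes d_pos: "0 < d"
    and open_P: "open P" and P_nonempty: "P \<noteq> {}" and convex_P: "convex P"
    and scale: "\<lbrakk>w \<in> P; 0 < c\<rbrakk> \<Longrightarrow> c *\<^sub>R w \<in> P"
    and dual_P: "\<lbrakk>\<And>w. w \<in> P \<Longrightarrow> 0 \<le> w \<bullet> s; e \<in> P\<rbrakk> \<Longrightarrow> s + e \<in> P"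
    and phi_scale: "\<lbrakk>w \<in> P; 0 < c\<rbrakk> \<Longrightarrow> \<phi> (c *\<^sub>R w) = \<phi> w + d * ln c"
    and fenchel: "\<lbrakk>w \<in> P; s \<in> P\<rbrakk> \<Longrightarrow> \<phi> w + \<phi> s \<le> w \<bullet> s - d"
    and iota_P: "w \<in> P \<Longrightarrow> \<iota> w \<in> P"
    and phi_iota: "w \<in> P \<Longrightarrow> \<phi> (\<iota> w) = - \<phi> w"
    and inner_iota: "w \<in> P \<Longrightarrow> w \<bullet> \<iota> w = d"
    and continuous_phi: "continuous_on P \<phi>"
    and continuous_iota: "continuous_on P \<iota>"
begin

definition hypo :: "(real \<times> real \<times> 'a) set"
  where "hypo = {(u, v, w). 0 < v \<and> w \<in> P \<and> u \<le> v * \<phi> (w /\<^sub>R v)}"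

definition strict_hypo :: "(real \<times> real \<times> 'a) set"
  where "strict_hypo = {(u, v, w). 0 < v \<and> w \<in> P \<and> u < v * \<phi> (w /\<^sub>R v)}"

definition strict_dual :: "(real \<times> real \<times> 'a) set"
  where "strict_dual = {(p, q, r). p < 0 \<and> r \<in> P \<and> p * (\<phi> (r /\<^sub>R (- p)) + d) < q}"

definition barrier :: "real \<times> real \<times> 'a \<Rightarrow> real"
  where "barrier = (\<lambda>(u, v, w). - ln (v * \<phi> (w /\<^sub>R v) - u) - ln v - \<phi> w)"

lemma open_half_domain: "open {(u :: real, v :: real, w). 0 < v \<and> w \<in> P}"
proof -
  have "{(u :: real, v :: real, w). 0 < v \<and> w \<in> P} = UNIV \<times> {0<..} \<times> P" by auto
  then show ?thesis by (simp add: open_Times open_P)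
qed

lemma open_strict_hypo: "open strict_hypo"
proof -
  let ?A = "{(u :: real, v :: real, w). 0 < v \<and> w \<in> P}"
  let ?g = "\<lambda>x. fst (snd x) * \<phi> (snd (snd x) /\<^sub>R fst (snd x)) - fst x :: real"
  have "continuous_on ?A ?g"
    by (intro continuous_intros continuous_on_compose2[OF continuous_phi]) (auto intro: scale)
  then have "open (?A \<inter> ?g -` {0<..})"
    by (intro continuous_open_preimage open_half_domain open_greaterThan)
  also have "?A \<inter> ?g -` {0<..} = strict_hypo" by (auto simp: strict_hypo_def)
  finally show ?thesis .
qed

lemma open_strict_dual: "open strict_dual"
proof -
  let ?A = "{..<0::real} \<times> (UNIV :: real set) \<times> P"
  let ?g = "\<lambda>x. fst (snd x) - fst x * (\<phi> (snd (snd x) /\<^sub>R (- fst x)) + d) :: real"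
  have "continuous_on ?A ?g"
    by (intro continuous_intros continuous_on_compose2[OF continuous_phi])
      (auto intro!: scale simp del: inverse_minus_eq scaleR_minus_left)
  moreover have "open ?A" by (simp add: open_Times open_P)
  ultimately have "open (?A \<inter> ?g -` {0<..})"
    by (intro continuous_open_preimage open_greaterThan)
  also have "?A \<inter> ?g -` {0<..} = strict_dual" by (auto simp: strict_dual_def)
  finally show ?thesis .
qed

text \<open>By the Fenchel inequality at \<open>w / v\<close>, the function \<open>v * \<phi> (w / v)\<close> is a minimum of
  the linear functions \<open>S \<bullet> w - (d + \<phi> S) * v\<close>.\<close>

lemma hypo_eq_halfspaces:
  "hypo = (UNIV \<times> {0<..} \<times> P) \<inter> (\<Inter>S\<in>P. {x. (1, d + \<phi> S, - S) \<bullet> x \<le> 0})"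
proof -
  have "(u \<le> v * \<phi> (w /\<^sub>R v)) \<longleftrightarrow> (\<forall>S\<in>P. u + (d + \<phi> S) * v \<le> S \<bullet> w)"
    if v: "0 < v" and w: "w \<in> P" for u v w
  proof -
    have wv: "w /\<^sub>R v \<in> P" using v w by (simp add: scale)
    have "v * \<phi> (w /\<^sub>R v) \<le> S \<bullet> w - (d + \<phi> S) * v" if "S \<in> P" for S
    proof -
      have "v * \<phi> (w /\<^sub>R v) \<le> v * ((w /\<^sub>R v) \<bullet> S - d - \<phi> S)"
        using fenchel[OF wv that] v by (intro mult_left_mono) auto
      also have "\<dots> = S \<bullet> w - (d + \<phi> S) * v"
        using v by (simp add: algebra_simps inner_commute)
      finally show ?thesis .
    qed
    moreover have "\<iota> (w /\<^sub>R v) \<bullet> w - (d + \<phi> (\<iota> (w /\<^sub>R v))) * v = v * \<phi> (w /\<^sub>R v)"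
      using inner_iota[OF wv] phi_iota[OF wv] v by (simp add: field_simps inner_commute)
    ultimately show ?thesis using iota_P[OF wv] by (smt (verit))
  qed
  then show ?thesis
    by (auto simp: hypo_def algebra_simps)
qed

lemma convex_hypo: "convex hypo"
  unfolding hypo_eq_halfspaces
proof (rule convex_Int)
  show "convex (UNIV \<times> {0<..} \<times> P :: (real \<times> real \<times> 'a) set)"
    by (intro convex_Times convex_P convex_UNIV convex_real_interval)
  show "convex (\<Inter>S\<in>P. {x. (1, d + \<phi> S, - S) \<bullet> x \<le> 0})"
    by (rule convex_INT) (rule convex_halfspace_le)
qed

lemma interior_hypo: "interior hypo = strict_hypo"
proof
  show "strict_hypo \<subseteq> interior hypo"
    by (rule interior_maximal[OF _ open_strict_hypo]) (auto simp: strict_hypo_def hypo_def)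
  show "interior hypo \<subseteq> strict_hypo"
  proof
    fix x assume x: "x \<in> interior hypo"
    obtain u v w where [simp]: "x = (u, v, w)" by (cases x)
    obtain e where e: "0 < e" "cball x e \<subseteq> hypo" using x mem_interior_cball by blast
    have "(u + e, v, w) \<in> cball x e" using e by (simp add: dist_Pair_Pair dist_real_def)
    then have "(u + e, v, w) \<in> hypo" using e by blast
    then show "x \<in> strict_hypo" using e by (auto simp: hypo_def strict_hypo_def)
  qed
qed

text \<open>Passing to the closure of a convex set does not enlarge its interior.\<close>

lemma interior_cone: "interior (closure hypo) = strict_hypo"
  by (simp add: convex_interior_closure convex_hypo interior_hypo)

text \<open>Necessary conditions, each obtained by testing a dual vector on suitable points of the
  hypograph: \<open>u\<close> tending to minus infinity, \<open>w\<close> going to infinity along a ray, and the point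
  where the Fenchel inequality for \<open>- r / p\<close> is an equality.\<close>

lemma dual_coneD:
  assumes "(p, q, r) \<in> dual_cone (closure hypo)"
  shows "p \<le> 0" "w \<in> P \<Longrightarrow> 0 \<le> w \<bullet> r"
    "\<lbrakk>p < 0; r \<in> P\<rbrakk> \<Longrightarrow> p * (\<phi> (r /\<^sub>R (- p)) + d) \<le> q"
proof -
  have *: "0 \<le> u * p + v * q + w \<bullet> r" if "0 < v" "w \<in> P" "u \<le> v * \<phi> (w /\<^sub>R v)" for u v w
  proof -
    have "(u, v, w) \<in> closure hypo" using that by (intro subsetD[OF closure_subset]) (simp add: hypo_def)
    then show ?thesis using assms by (auto simp: dual_cone_def)
  qed
  show "p \<le> 0"
  proof (rule ccontr)
    assume "\<not> p \<le> 0"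
    then have p: "0 < p" by simp
    obtain w where w: "w \<in> P" using P_nonempty by blast
    define u where "u = min (\<phi> w) ((- q - w \<bullet> r - 1) / p)"
    have "u * p \<le> - q - w \<bullet> r - 1"
      using p by (simp add: u_def min_def field_simps)
    then show False using *[of 1 w u] w by (simp add: u_def)
  qed
  show "0 \<le> w \<bullet> r" if w: "w \<in> P"
  proof (rule ccontr)
    \<comment> \<open>Along the ray through \<open>w\<close> the inner product grows linearly, but \<open>\<phi>\<close> only logarithmically.\<close>
    assume "\<not> 0 \<le> w \<bullet> r"
    have ev: "0 \<le> (\<phi> w + d * ln t) * p + q + t * (w \<bullet> r)" if "0 < t" for t
      using *[of 1 "t *\<^sub>R w" "\<phi> w + d * ln t"] w that by (simp add: scale phi_scale)
    have "((\<lambda>t. (\<phi> w * p + q) * (1/t) + d * p * (ln t / t) + w \<bullet> r) \<longlongrightarrow>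
        (\<phi> w * p + q) * 0 + d * p * 0 + w \<bullet> r) at_top"
      by (intro tendsto_intros lim_ln_over_power ln_x_over_x_tendsto_0 tendsto_divide_0[OF tendsto_const]
          filterlim_ident filterlim_at_top_imp_at_infinity)
    moreover have "\<forall>\<^sub>F t in at_top. 0 \<le> (\<phi> w * p + q) * (1/t) + d * p * (ln t / t) + w \<bullet> r"
      using eventually_gt_at_top[of 0]
    proof eventually_elim
      case (elim t)
      have "0 \<le> ((\<phi> w + d * ln t) * p + q + t * (w \<bullet> r)) / t" using ev[OF elim] elim by simp
      also have "\<dots> = (\<phi> w * p + q) * (1/t) + d * p * (ln t / t) + w \<bullet> r"
        using elim by (simp add: field_simps)
      finally show ?case .
    qed
    ultimately have "0 \<le> w \<bullet> r" by (simp add: tendsto_lowerbound)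
    then show False using \<open>\<not> 0 \<le> w \<bullet> r\<close> by simp
  qed
  show "p * (\<phi> (r /\<^sub>R (- p)) + d) \<le> q" if p: "p < 0" and r: "r \<in> P"
  proof -
    let ?y = "r /\<^sub>R (- p)"
    have y: "?y \<in> P" using p r by (intro scale) auto
    have "\<iota> ?y \<bullet> r = (- p) * (?y \<bullet> \<iota> ?y)" using p by (simp add: inner_commute)
    also have "\<dots> = - p * d" by (simp only: inner_iota[OF y])
    finally have "\<iota> ?y \<bullet> r = - p * d" .
    then show ?thesis using *[of 1 "\<iota> ?y" "\<phi> (\<iota> ?y)"] iota_P[OF y] phi_iota[OF y]
      by (simp add: algebra_simps)
  qed
qed

text \<open>For \<open>S = - r / p\<close>, the pairing with \<open>(p, q, r)\<close> is at least \<open>- p\<close> times the linear function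
  \<open>S \<bullet> w - (d + \<phi> S) * v - u\<close>, which is nonnegative on the hypograph by \<open>hypo_eq_halfspaces\<close>.\<close>

lemma strict_dual_subset: "strict_dual \<subseteq> dual_cone (closure hypo)"
proof
  fix x assume x: "x \<in> strict_dual"
  obtain p q r where [simp]: "x = (p, q, r)" by (cases x)
  have p: "p < 0" and r: "r \<in> P" and q: "p * (\<phi> (r /\<^sub>R (- p)) + d) < q"
    using x by (auto simp: strict_dual_def)
  let ?y = "r /\<^sub>R (- p)"
  have y: "?y \<in> P" using p r by (intro scale) auto
  have "hypo \<subseteq> {z. x \<bullet> z \<ge> 0}"
  proof
    fix z assume z: "z \<in> hypo"
    obtain u v w where [simp]: "z = (u, v, w)" by (cases z)
    have "0 \<le> u * - 1 + (- (d + \<phi> ?y)) * v + ?y \<bullet> w" and v: "0 < v"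
      using z y unfolding hypo_eq_halfspaces by (auto simp: algebra_simps)
    then have "0 \<le> (- p) * (u * - 1 + (- (d + \<phi> ?y)) * v + ?y \<bullet> w)"
      using p by (simp add: mult_nonpos_nonneg)
    also have "\<dots> = p * u + (p * (\<phi> ?y + d)) * v + r \<bullet> w" using p by (simp add: field_simps)
    also have "\<dots> \<le> p * u + q * v + r \<bullet> w"
      using v q by simp
    finally show "z \<in> {z. x \<bullet> z \<ge> 0}" by (simp add: inner_commute)
  qed
  then have "closure hypo \<subseteq> {z. x \<bullet> z \<ge> 0}"
    by (rule closure_minimal) (rule closed_halfspace_ge)
  then show "x \<in> dual_cone (closure hypo)" by (auto simp: dual_cone_def inner_commute)
qed

text \<open>An interior point can be moved a little towards larger \<open>p\<close>, smaller \<open>q\<close> and smaller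
  \<open>r\<close>, which makes the inequalities of \<open>dual_coneD\<close> strict and
  puts \<open>r\<close> into the open cone \<open>P\<close>.\<close>

lemma interior_dual_cone: "interior (dual_cone (closure hypo)) = strict_dual"
proof
  show "strict_dual \<subseteq> interior (dual_cone (closure hypo))"
    by (rule interior_maximal[OF strict_dual_subset open_strict_dual])
  show "interior (dual_cone (closure hypo)) \<subseteq> strict_dual"
  proof
    fix x assume x: "x \<in> interior (dual_cone (closure hypo))"
    obtain p q r where [simp]: "x = (p, q, r)" by (cases x)
    obtain e where e: "0 < e" "cball x e \<subseteq> dual_cone (closure hypo)"
      using x mem_interior_cball by blast
    have "(p + e, q, r) \<in> cball x e" "(p, q - e, r) \<in> cball x e"
      using e by (auto simp: dist_Pair_Pair dist_real_def)
    then have 1: "(p + e, q, r) \<in> dual_cone (closure hypo)"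
      and 2: "(p, q - e, r) \<in> dual_cone (closure hypo)" using e by blast+
    have p: "p < 0" using dual_coneD(1)[OF 1] e by simp
    obtain b where b: "b \<in> P" using P_nonempty by blast
    obtain c where c: "0 < c" "norm (c *\<^sub>R b) \<le> e"
    proof
      show "0 < e / (norm b + 1)" using e by (simp add: add_nonneg_pos)
      show "norm ((e / (norm b + 1)) *\<^sub>R b) \<le> e"
        using mult_left_mono[of "norm b" "norm b + 1" e] e by (simp add: divide_le_eq add_nonneg_pos)
    qed
    have "(p, q, r - c *\<^sub>R b) \<in> cball x e"
      using c by (simp add: dist_Pair_Pair dist_norm)
    then have "(p, q, r - c *\<^sub>R b) \<in> dual_cone (closure hypo)" using e by blast
    then have "(r - c *\<^sub>R b) + c *\<^sub>R b \<in> P"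
      using b c by (intro dual_P dual_coneD(2) scale)
    then have r: "r \<in> P" by simp
    show "x \<in> strict_dual"
      using dual_coneD(3)[OF 2 p r] e p r by (simp add: strict_dual_def)
  qed
qed

definition \<Omega> :: "real \<times> real \<times> 'a \<Rightarrow> real"
  where "\<Omega> = (\<lambda>(p, q, r). d * wright_omega ((1 / d) * (1 + d - q / p + \<phi> (r /\<^sub>R (- p))) - ln d))"

text \<open>The stationary point of \<open>z \<mapsto> - (x \<bullet> z) - barrier z\<close>. Put \<open>a = p * (1 - \<Omega>)\<close> and
  \<open>b = - p * \<Omega> = a - p\<close>. Stationarity in \<open>u\<close> gives \<open>v * \<phi> (w / v) - u = - 1 / p\<close>; stationarity
  in \<open>w\<close> makes \<open>\<iota> (w / v)\<close> equal to \<open>r / b\<close> with \<open>a = 1 / v\<close>; stationarity in \<open>v\<close> becomes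
  the equation of lemma \<open>Omega_eq\<close>.\<close>

definition maximizer :: "real \<times> real \<times> 'a \<Rightarrow> real \<times> real \<times> 'a"
  where "maximizer = (\<lambda>(p, q, r). let om = \<Omega> (p, q, r) in
    ((d + 2 - q / p - 2 * om) / (p * (1 - om)), 1 / (p * (1 - om)), (om / (om - 1)) *\<^sub>R \<iota> r))"

lemma Omega_pos: "0 < \<Omega> x"
  by (cases x) (simp add: \<Omega>_def wright_omega d_pos)

lemma Omega_eq: "\<Omega> (p, q, r) + d * ln (\<Omega> (p, q, r)) = 1 + d - q / p + \<phi> (r /\<^sub>R (- p))"
proof -
  let ?b = "(1 / d) * (1 + d - q / p + \<phi> (r /\<^sub>R (- p))) - ln d"
  have "d * wright_omega ?b + d * ln (d * wright_omega ?b)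
      = d * (wright_omega ?b + ln (wright_omega ?b)) + d * ln d"
    using d_pos wright_omega(1)[of ?b] by (simp add: ln_mult_pos distrib_left)
  also have "\<dots> = d * ?b + d * ln d" by (simp only: wright_omega(2))
  also have "\<dots> = 1 + d - q / p + \<phi> (r /\<^sub>R (- p))"
    using d_pos by (simp add: right_diff_distrib)
  finally show ?thesis by (simp add: \<Omega>_def)
qed

text \<open>The left side of \<open>Omega_eq\<close> is increasing in \<open>\<Omega>\<close> and equals 1 at \<open>\<Omega> = 1\<close>; its right
  side exceeds 1 exactly by the strict inequality that describes the interior of the dual cone.\<close>

lemma Omega_gt_1:
  assumes "x \<in> strict_dual"
  shows "1 < \<Omega> x"
proof (rule ccontr)
  assume "\<not> 1 < \<Omega> x"
  then have "\<Omega> x + d * ln (\<Omega> x) \<le> 1 + d * 0"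
    using d_pos Omega_pos[of x] by (intro add_mono mult_left_mono) auto
  moreover obtain p q r where x: "x = (p, q, r)" by (cases x)
  ultimately have "\<phi> (r /\<^sub>R (- p)) + d \<le> q / p" by (simp only: Omega_eq x)
  moreover have "p < 0" "p * (\<phi> (r /\<^sub>R (- p)) + d) < q" using assms x by (auto simp: strict_dual_def)
  ultimately show False by (simp add: field_simps)
qed

lemma continuous_on_Omega: "continuous_on strict_dual \<Omega>"
proof -
  have "continuous_on strict_dual (\<lambda>x. \<phi> (snd (snd x) /\<^sub>R (- fst x)))"
    by (intro continuous_intros continuous_on_compose2[OF continuous_phi])
      (auto intro!: scale simp: strict_dual_def simp del: inverse_minus_eq scaleR_minus_left)
  then show ?thesis
    unfolding \<Omega>_def case_prod_beta
    by (intro continuous_intros continuous_on_compose2[OF continuous_on_wright_omega])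
      (use d_pos in \<open>auto simp: strict_dual_def\<close>)
qed

lemma continuous_on_maximizer: "continuous_on strict_dual maximizer"
proof -
  have "continuous_on strict_dual (\<lambda>x. \<iota> (snd (snd x)))"
    by (intro continuous_intros continuous_on_compose2[OF continuous_iota])
      (auto simp: strict_dual_def)
  moreover have "\<Omega> x \<noteq> 1" "fst x \<noteq> 0" if "x \<in> strict_dual" for x
    using that Omega_gt_1[OF that] by (auto simp: strict_dual_def)
  ultimately show ?thesis
    unfolding maximizer_def case_prod_beta Let_def
    by (simp del: prod.collapse add: prod.collapse)
      (intro continuous_intros continuous_on_Omega; simp)
qed

text \<open>At the stationary point the concave terms of the objective have the tangents
  \<open>ln h \<le> - p * h - 1 - ln (- p)\<close>, \<open>ln v \<le> a * v - 1 - ln a\<close>, and the Fenchel inequalities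
  for \<open>\<phi> (w / v)\<close> with \<open>S = r / b\<close> and for \<open>\<phi> w\<close> with \<open>a *\<^sub>R S\<close>. In their sum the
  coefficients of \<open>h\<close>, \<open>v\<close> and \<open>w\<close> cancel, and the remaining constant is the
  value of the objective at the stationary point.\<close>

lemma maximizer:
  assumes x: "x \<in> strict_dual"
  shows "maximizer x \<in> strict_hypo"
    and "z \<in> strict_hypo \<Longrightarrow>
      - (x \<bullet> z) - barrier z \<le> - (x \<bullet> maximizer x) - barrier (maximizer x)"
proof -
  obtain p q r where x_eq: "x = (p, q, r)" by (cases x)
  have p: "p < 0" and r: "r \<in> P" using x by (auto simp: x_eq strict_dual_def)
  define om where "om = \<Omega> x"
  have om: "1 < om" using Omega_gt_1[OF x] by (simp add: om_def)
  define a where "a = p * (1 - om)"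
  define b where "b = - p * om"
  have a: "0 < a" using p om by (simp add: a_def mult_neg_neg)
  have b: "0 < b" using p om by (simp add: b_def mult_neg_pos)
  have ab: "a - p = b" by (simp add: a_def b_def algebra_simps)
  define S where "S = r /\<^sub>R b"
  have S: "S \<in> P" using r b by (simp add: S_def scale)
  have rS: "r = b *\<^sub>R S" using b by (simp add: S_def)
  have "S = (inverse om) *\<^sub>R (r /\<^sub>R (- p))"
    using p om by (simp add: S_def b_def)
  then have "\<phi> S = \<phi> (r /\<^sub>R (- p)) + d * ln (inverse om)"
    using p om r by (simp only:) (intro phi_scale scale; simp)
  then have phiS: "\<phi> S = om - 1 - d + q / p"
    using Omega_eq[of p q r] om by (simp add: om_def x_eq ln_inverse)
  \<comment> \<open>Stationarity in \<open>v\<close>, in the form that makes the coefficient of \<open>v\<close> cancel below.\<close>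
  have aS: "a = q - p * (d + \<phi> S)"
    using p by (simp add: phiS a_def field_simps)
  define y where "y = b *\<^sub>R \<iota> r"
  have y: "y \<in> P" using r b by (simp add: y_def scale iota_P)
  have phiy: "\<phi> y = - \<phi> S"
  proof -
    have "\<phi> r = \<phi> S + d * ln b" using phi_scale[OF S b] by (simp add: rS)
    moreover have "\<phi> y = - \<phi> r + d * ln b"
      using phi_scale[OF iota_P[OF r] b] phi_iota[OF r] by (simp add: y_def)
    ultimately show ?thesis by simp
  qed
  have ry: "r \<bullet> y = b * d" using inner_iota[OF r] by (simp add: y_def)
  define u where "u = - \<phi> S / a + 1 / p"
  have max_eq: "maximizer x = ((d + 2 - q / p - 2 * om) / a, 1 / a, (om / (om - 1)) *\<^sub>R \<iota> r)"
    by (simp add: maximizer_def x_eq om_def a_def Let_def)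
  have "om / (om - 1) = b / a" using p om by (simp add: a_def b_def field_simps)
  moreover have "(d + 2 - q / p - 2 * om) / a = u"
    using a p om by (simp add: u_def phiS) (simp add: a_def field_simps)
  ultimately have m: "maximizer x = (u, 1 / a, y /\<^sub>R a)"
    by (simp only: max_eq) (simp add: y_def divide_inverse mult.commute)
  have h: "(1 / a) * \<phi> ((y /\<^sub>R a) /\<^sub>R (1 / a)) - u = - 1 / p"
    using a by (simp add: phiy u_def)
  show "maximizer x \<in> strict_hypo"
    using h a p y by (simp add: m strict_hypo_def scale) (smt (verit) divide_less_0_iff)
  have opt: "- (x \<bullet> maximizer x) - barrier (maximizer x) = - (d + 2) - ln (- p) - ln a - (\<phi> S + d * ln a)"
  proof -
    have "x \<bullet> maximizer x = p * u + q / a + b * d / a"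
      by (subst m) (simp add: x_eq ry divide_inverse mult.commute)
    also have "\<dots> = (a + q - p * \<phi> S + b * d) / a"
      using a p by (simp add: u_def field_simps)
    also have "a + q - p * \<phi> S + b * d = (d + 2) * a"
      using aS unfolding ab[symmetric] by (simp add: algebra_simps)
    also have "\<dots> / a = d + 2" using a by simp
    finally have 1: "x \<bullet> maximizer x = d + 2" .
    have "\<phi> (y /\<^sub>R a) = - \<phi> S - d * ln a"
      using phi_scale[OF y, of "inverse a"] a by (simp add: phiy ln_inverse)
    moreover have "ln (- 1 / p) = - ln (- p)" using p ln_inverse[of "- p"] by (simp add: divide_inverse)
    moreover have "ln (1 / a) = - ln a" using a by (simp add: ln_div)
    ultimately have "barrier (maximizer x) = ln (- p) + ln a + \<phi> S + d * ln a"
      using h by (simp only: m barrier_def case_prod_conv)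
    with 1 show ?thesis by simp
  qed
  show "- (x \<bullet> z) - barrier z \<le> - (x \<bullet> maximizer x) - barrier (maximizer x)" if z: "z \<in> strict_hypo"
  proof -
    obtain u' v w where z_eq: "z = (u', v, w)" by (cases z)
    define h' where "h' = v * \<phi> (w /\<^sub>R v) - u'"
    have v: "0 < v" and w: "w \<in> P" and h': "0 < h'"
      using z by (auto simp: z_eq strict_hypo_def h'_def)
    \<comment> \<open>The four tangent inequalities, at \<open>h' = - 1 / p\<close>, \<open>v = 1 / a\<close>, \<open>\<iota> (w / v) = S\<close> and \<open>\<iota> w = a S\<close>.\<close>
    have 1: "p * h' + ln h' \<le> - 1 - ln (- p)"
      using ln_le_minus_one[of "(- p) * h'"] ln_mult_pos[of "- p" h'] p h' by (simp add: mult_neg_pos)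
    have 2: "ln v \<le> a * v - 1 - ln a"
      using ln_le_minus_one[of "a * v"] ln_mult_pos[of a v] a v by simp
    have 3: "(- p * v) * \<phi> (w /\<^sub>R v) \<le> (- p * v) * ((w /\<^sub>R v) \<bullet> S - d - \<phi> S)"
      using fenchel[of "w /\<^sub>R v" S] v w S p by (intro mult_left_mono) (auto simp: scale mult_nonpos_nonneg)
    have "\<dots> = - p * (w \<bullet> S) + p * v * (d + \<phi> S)"
      using v by (simp add: field_simps)
    with 3 have 3: "(- p * v) * \<phi> (w /\<^sub>R v) \<le> - p * (w \<bullet> S) + p * v * (d + \<phi> S)" by simp
    have 4: "\<phi> w \<le> a * (w \<bullet> S) - d - (\<phi> S + d * ln a)"
      using fenchel[OF w scale[OF S a]] phi_scale[OF S a] by simp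
    have "- (x \<bullet> z) - barrier z = (p * h' + ln h') - p * v * \<phi> (w /\<^sub>R v) - q * v - r \<bullet> w + ln v + \<phi> w"
      by (simp add: x_eq z_eq barrier_def h'_def[symmetric]) (simp add: h'_def algebra_simps)
    also have "\<dots> \<le> (- 1 - ln (- p)) + (- p * (w \<bullet> S) + p * v * (d + \<phi> S)) - q * v - r \<bullet> w
        + (a * v - 1 - ln a) + (a * (w \<bullet> S) - d - (\<phi> S + d * ln a))"
      using 1 2 3 4 by simp
    also have "\<dots> = - (d + 2) - ln (- p) - ln a - (\<phi> S + d * ln a) + (a - p - b) * (w \<bullet> S)
        + (a - (q - p * (d + \<phi> S))) * v"
      by (simp add: rS inner_commute algebra_simps)
    also have "\<dots> = - (d + 2) - ln (- p) - ln a - (\<phi> S + d * ln a)"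
      using ab aS by simp
    finally show ?thesis by (simp only: opt)
  qed
qed

text \<open>The supremum ranges over the interior of the cone, so a barrier matters only through its
  values there. This is what allows the log-determinant barrier, given through a choice of
  eigenvalues, to be treated as an instance.\<close>

context
  fixes f :: "real \<times> real \<times> 'a \<Rightarrow> real"
  assumes f: "\<And>x. x \<in> strict_hypo \<Longrightarrow> f x = barrier x"
begin

lemma bdd_above_conjugate:
  assumes "s \<in> strict_dual"
  shows "bdd_above ((\<lambda>w. - (s \<bullet> w) - f w) ` interior (closure hypo))"
proof (rule bdd_aboveI2)
  fix w assume "w \<in> interior (closure hypo)"
  then show "- (s \<bullet> w) - f w \<le> - (s \<bullet> maximizer s) - barrier (maximizer s)"
    using maximizer(2)[OF assms] by (simp add: interior_cone f)
qed

lemma conjugate_barrier_eq: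
  assumes "s \<in> strict_dual"
  shows "conjugate_barrier (closure hypo) f s = - (s \<bullet> maximizer s) - f (maximizer s)"
  unfolding conjugate_barrier_def interior_cone
proof (rule cSup_eq_maximum)
  show "- (s \<bullet> maximizer s) - f (maximizer s) \<in> (\<lambda>w. - (s \<bullet> w) - f w) ` strict_hypo"
    using maximizer(1)[OF assms] by (rule imageI)
  fix y assume "y \<in> (\<lambda>w. - (s \<bullet> w) - f w) ` strict_hypo"
  then show "y \<le> - (s \<bullet> maximizer s) - f (maximizer s)"
    using maximizer[OF assms] by (auto simp: f)
qed

lemma GDERIV_conjugate_barrier:
  assumes "s \<in> strict_dual"
  shows "GDERIV (conjugate_barrier (closure hypo) f) s :> - maximizer s"
proof (rule GDERIV_sup_of_affine[where f = f and A = strict_hypo])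
  show "maximizer t \<in> strict_hypo" if "t \<in> strict_dual" for t
    using that by (rule maximizer)
  show "- (t \<bullet> w) - f w \<le> conjugate_barrier (closure hypo) f t"
    if "t \<in> strict_dual" "w \<in> strict_hypo" for t w
    using maximizer[OF that(1)] that by (simp add: conjugate_barrier_eq f)
qed (simp_all add: open_strict_dual assms continuous_on_maximizer conjugate_barrier_eq)

lemma conjugate_gradient_eq:
  assumes "s \<in> strict_dual"
  shows "conjugate_gradient (closure hypo) f s = - maximizer s"
  unfolding conjugate_gradient_def
proof (rule the_equality)
  show "GDERIV (conjugate_barrier (closure hypo) f) s :> - maximizer s"
    using assms by (rule GDERIV_conjugate_barrier)
  then show "g = - maximizer s" if "GDERIV (conjugate_barrier (closure hypo) f) s :> g" for g
    using that by (rule GDERIV_unique[rotated])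
qed

lemma conjugate_gradient_exists:
  assumes "s \<in> strict_dual"
  shows "conjugate_gradient_exists (closure hypo) f s"
  unfolding conjugate_gradient_exists_def interior_dual_cone
  using assms bdd_above_conjugate GDERIV_conjugate_barrier[OF assms] by (intro conjI ballI exI)

end

end


section \<open>The positive orthant\<close>

text \<open>The case of \<open>t\<close> tending to 0, used where a boundary point of an open cone is approached
  along a line, and to extract a first-order condition from a quadratic inequality.\<close>

lemma nonneg_if_perturbations_nonneg:
  fixes a b :: real
  assumes perturbed: "\<And>t. 0 < t \<Longrightarrow> 0 \<le> a + t * b"
  shows "0 \<le> a"
proof (rule ccontr)
  assume "\<not> 0 \<le> a"
  define c where "c = \<bar>b\<bar> + 1"
  have c: "0 < c" by (simp add: c_def add_nonneg_pos)
  then have t: "0 < - a / c" using \<open>\<not> 0 \<le> a\<close> by (simp add: divide_neg_pos)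
  then have "- a / c * b < - a / c * c" by (intro mult_strict_left_mono) (auto simp: c_def)
  also have "- a / c * c = - a" using c by simp
  finally show False using perturbed[OF t] by simp
qed

definition pos_orthant :: "(real^'d) set"
  where "pos_orthant = {w. \<forall>i. 0 < w $ i}"

definition inv_vec :: "real^'d \<Rightarrow> real^'d"
  where "inv_vec w = (\<chi> i. 1 / w $ i)"

lemma log_homogeneous_sum_log:
  "log_homogeneous (pos_orthant :: (real^'d) set) sum_log inv_vec (real CARD('d))"
proof
  show "open (pos_orthant :: (real^'d) set)"
  proof -
    have eq: "pos_orthant = (\<Inter>i. {w :: real^'d. 0 < w $ i})" by (auto simp: pos_orthant_def)
    show ?thesis unfolding eq by (intro open_INT ballI open_halfspace_component_gt_cart) simp
  qed
  show "pos_orthant \<noteq> ({} :: (real^'d) set)"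
    by (auto simp: pos_orthant_def intro!: exI[of _ "vec 1"])
  show "convex (pos_orthant :: (real^'d) set)"
    by (rule convexI) (auto simp: pos_orthant_def add_nonneg_pos add_pos_nonneg zero_le_mult_iff zero_less_mult_iff less_eq_real_def)
  fix w s e :: "real^'d" and c :: real
  show "c *\<^sub>R w \<in> pos_orthant" if "w \<in> pos_orthant" "0 < c"
    using that by (simp add: pos_orthant_def)
  show "s + e \<in> pos_orthant" if s: "\<And>w. w \<in> pos_orthant \<Longrightarrow> 0 \<le> w \<bullet> s" and e: "e \<in> pos_orthant"
  proof -
    have "0 \<le> s $ i" for i
    proof (rule nonneg_if_perturbations_nonneg)
      fix t :: real assume "0 < t"
      then have "axis i 1 + t *\<^sub>R 1 \<in> pos_orthant" by (auto simp: pos_orthant_def axis_def)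
      from s[OF this] show "0 \<le> s $ i + t * (1 \<bullet> s)"
        by (simp add: inner_add_left inner_axis')
    qed
    then show ?thesis using e by (simp add: pos_orthant_def add_nonneg_pos)
  qed
  show "sum_log (c *\<^sub>R w) = sum_log w + real CARD('d) * ln c" if "w \<in> pos_orthant" "0 < c"
    using that by (simp add: sum_log_def pos_orthant_def ln_mult_pos sum.distrib)
  show "sum_log w + sum_log s \<le> w \<bullet> s - real CARD('d)" if "w \<in> pos_orthant" "s \<in> pos_orthant"
  proof -
    have "sum_log w + sum_log s = (\<Sum>i\<in>UNIV. ln (w $ i * s $ i))"
      using that by (simp add: sum_log_def pos_orthant_def ln_mult_pos sum.distrib)
    also have "\<dots> \<le> (\<Sum>i\<in>UNIV. w $ i * s $ i - 1)"
      using that by (intro sum_mono ln_le_minus_one) (simp add: pos_orthant_def)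
    finally show ?thesis by (simp add: inner_vec_def sum_subtractf)
  qed
  show "inv_vec w \<in> pos_orthant" if "w \<in> pos_orthant"
    using that by (simp add: pos_orthant_def inv_vec_def)
  show "sum_log (inv_vec w) = - sum_log w" if "w \<in> pos_orthant"
    by (simp add: sum_log_def inv_vec_def divide_inverse ln_inverse sum_negf)
  show "w \<bullet> inv_vec w = real CARD('d)" if "w \<in> pos_orthant"
    using that by (simp add: inner_vec_def inv_vec_def pos_orthant_def less_imp_neq[symmetric])
  show "continuous_on pos_orthant (sum_log :: real^'d \<Rightarrow> real)"
    unfolding sum_log_def by (intro continuous_intros) (auto simp: pos_orthant_def less_imp_neq[symmetric])
  show "continuous_on pos_orthant (inv_vec :: real^'d \<Rightarrow> _)"
    unfolding inv_vec_def by (intro continuous_intros) (auto simp: pos_orthant_def less_imp_neq[symmetric])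
qed simp


section \<open>The spectral theorem for symmetric matrices\<close>

lemma inner_matrix_vector_symmetric:
  fixes A :: "real^'n^'n"
  assumes "transpose A = A"
  shows "(A *v x) \<bullet> y = x \<bullet> (A *v y)"
proof -
  have "A *v x = x v* A" using transpose_matrix_vector[of A x] assms by simp
  then show ?thesis by (simp add: dot_lmul_matrix)
qed

text \<open>A maximizer \<open>x\<close> of the quadratic form on the unit sphere of \<open>V\<close> is an eigenvector: moving
  from \<open>x\<close> in the direction of the residual \<open>y = A *v x - \<mu> *\<^sub>R x\<close>, which stays in \<open>V\<close>, raises
  the Rayleigh quotient to first order by \<open>2 * (y \<bullet> y)\<close>, which must
  therefore vanish.\<close>

lemma symmetric_matrix_eigenvector_in_invariant_subspace:
  fixes A :: "real^'n^'n"
  assumes sym: "transpose A = A"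
    and V: "subspace V" "\<And>x. x \<in> V \<Longrightarrow> A *v x \<in> V" and z: "z \<in> V" "z \<noteq> 0"
  obtains x \<mu> where "x \<in> V" "norm x = 1" "A *v x = \<mu> *\<^sub>R x"
proof -
  let ?K = "V \<inter> sphere 0 1"
  have "compact ?K" by (simp add: V(1) closed_subspace closed_Int_compact)
  moreover have "(1 / norm z) *\<^sub>R z \<in> ?K" using z V(1) by (simp add: subspace_scale)
  moreover have "continuous_on ?K (\<lambda>x. x \<bullet> (A *v x))"
    by (intro continuous_intros matrix_vector_mult_linear_continuous_on)
  ultimately obtain x where x: "x \<in> ?K" "\<And>y. y \<in> ?K \<Longrightarrow> y \<bullet> (A *v y) \<le> x \<bullet> (A *v x)"
    using continuous_attains_sup[of ?K "\<lambda>x. x \<bullet> (A *v x)"] by blast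
  define \<mu> where "\<mu> = x \<bullet> (A *v x)"
  have max: "y \<bullet> (A *v y) \<le> \<mu> * (y \<bullet> y)" if y: "y \<in> V" for y
  proof (cases "y = 0")
    case False
    have "(1 / norm y) *\<^sub>R y \<in> ?K" using y V(1) False by (simp add: subspace_scale)
    from x(2)[OF this] have "(y \<bullet> (A *v y)) / (norm y)\<^sup>2 \<le> \<mu>"
      by (simp add: \<mu>_def matrix_vector_mult_scaleR power2_eq_square)
    then show ?thesis using False by (simp add: divide_le_eq power2_norm_eq_inner)
  qed simp
  define y where "y = A *v x - \<mu> *\<^sub>R x"
  have yV: "y \<in> V" using x V by (simp add: y_def subspace_diff subspace_scale)
  define c where "c = \<mu> * (y \<bullet> y) - y \<bullet> (A *v y)"
  have xx: "x \<bullet> x = 1" using x by (simp add: norm_eq_1)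
  have "0 \<le> - (2 * (y \<bullet> y)) + t * c" if t: "0 < t" for t
  proof -
    have "(x + t *\<^sub>R y) \<bullet> (A *v (x + t *\<^sub>R y)) \<le> \<mu> * ((x + t *\<^sub>R y) \<bullet> (x + t *\<^sub>R y))"
      using x yV V(1) by (intro max) (simp add: subspace_add subspace_scale)
    moreover have "x \<bullet> (A *v y) = y \<bullet> (A *v x)"
      using inner_matrix_vector_symmetric[OF sym, of x y] by (simp add: inner_commute)
    moreover have "y \<bullet> (A *v x) = y \<bullet> y + \<mu> * (x \<bullet> y)"
      by (simp add: y_def algebra_simps inner_commute)
    ultimately have "t * (2 * (y \<bullet> y)) \<le> t * (t * c)"
      by (simp add: c_def \<mu>_def[symmetric] xx matrix_vector_right_distrib matrix_vector_mult_scaleR inner_commute[of y x] algebra_simps)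
    then show ?thesis using t by simp
  qed
  then have "0 \<le> - (2 * (y \<bullet> y))" by (rule nonneg_if_perturbations_nonneg)
  then have "y \<bullet> y \<le> 0" by simp
  then have "y = 0" by (metis inner_gt_zero_iff not_le)
  then have "A *v x = \<mu> *\<^sub>R x" by (simp add: y_def)
  with x show thesis by (intro that[of x \<mu>]) simp_all
qed

text \<open>The orthogonal complement of a set of eigenvectors is invariant, so another eigenvector
  can be split off from it.\<close>

lemma symmetric_matrix_orthonormal_eigenvectors:
  fixes A :: "real^'n^'n"
  assumes sym: "transpose A = A" and "k \<le> CARD('n)"
  shows "\<exists>B. finite B \<and> card B = k \<and> pairwise orthogonal B \<and>
    (\<forall>b\<in>B. norm b = 1 \<and> (\<exists>\<mu>. A *v b = \<mu> *\<^sub>R b))"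
  using assms(2)
proof (induction k)
  case 0
  then show ?case by (intro exI[of _ "{}"]) simp
next
  case (Suc k)
  then obtain B where B: "finite B" "card B = k" "pairwise orthogonal B"
    and eig: "\<And>b. b \<in> B \<Longrightarrow> norm b = 1 \<and> (\<exists>\<mu>. A *v b = \<mu> *\<^sub>R b)" by auto
  define V where "V = {x. \<forall>b\<in>B. orthogonal b x}"
  have "dim B < DIM(real^'n)"
    using dim_le_card'[OF B(1)] B(2) Suc.prems by simp
  then obtain z where "z \<noteq> 0" "\<And>y. y \<in> span B \<Longrightarrow> orthogonal z y"
    using orthogonal_to_subspace_exists by blast
  then have z: "z \<in> V" "z \<noteq> 0" by (auto simp: V_def span_base orthogonal_commute)
  have V: "subspace V" unfolding V_def by (rule subspace_orthogonal_to_vectors)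
  have inv: "A *v x \<in> V" if x: "x \<in> V" for x
    unfolding V_def
  proof (intro CollectI ballI)
    fix b assume b: "b \<in> B"
    then obtain \<mu> where "A *v b = \<mu> *\<^sub>R b" using eig by blast
    then have "b \<bullet> (A *v x) = \<mu> * (b \<bullet> x)"
      using inner_matrix_vector_symmetric[OF sym, of b x] by simp
    then show "orthogonal b (A *v x)" using x b by (simp add: V_def orthogonal_def)
  qed
  obtain x \<mu> where x: "x \<in> V" "norm x = 1" "A *v x = \<mu> *\<^sub>R x"
    using symmetric_matrix_eigenvector_in_invariant_subspace[OF sym V inv z] .
  have "x \<notin> B" using x by (auto simp: V_def orthogonal_def norm_eq_1)
  moreover have "pairwise orthogonal (insert x B)"
    using x(1) B(3) by (auto simp: V_def pairwise_insert orthogonal_commute)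
  ultimately show ?case
    using B eig x by (intro exI[of _ "insert x B"]) auto
qed

lemma matrix_mult_Diag: "(M ** Diag l) $ i $ j = M $ i $ j * l $ j"
  by (simp add: matrix_matrix_mult_def Diag_def if_distrib[where f = "\<lambda>x. _ * x"] cong: if_cong)

lemma Diag_mult_Diag: "Diag a ** Diag b = Diag (\<chi> i. a $ i * b $ i)"
  by (simp add: vec_eq_iff matrix_mult_Diag) (simp add: Diag_def)

lemma det_Diag: "det (Diag l) = (\<Prod>i\<in>UNIV. l $ i)"
  by (subst det_diagonal) (simp_all add: Diag_def)

lemma transpose_Diag: "transpose (Diag l) = Diag l"
  by (simp add: vec_eq_iff transpose_def Diag_def)

lemma trace_Diag: "trace (Diag l) = (\<Sum>i\<in>UNIV. l $ i)"
  by (simp add: trace_def Diag_def)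

lemma transpose_mat_of_sym: "transpose (mat_of_sym W) = mat_of_sym W"
  using mat_of_sym[of W] by simp

lemma eigendecomposition_exists: "\<exists>U l. eigendecomposition W U l"
proof -
  let ?A = "mat_of_sym W"
  obtain B :: "(real^'a) set" where B: "finite B" "card B = CARD('a)" "pairwise orthogonal B"
    and eig: "\<And>b. b \<in> B \<Longrightarrow> norm b = 1 \<and> (\<exists>\<mu>. ?A *v b = \<mu> *\<^sub>R b)"
    using symmetric_matrix_orthonormal_eigenvectors[OF transpose_mat_of_sym[of W] order_refl] by auto
  obtain b where b: "bij_betw b (UNIV :: 'a set) B"
    using finite_same_card_bij[of "UNIV :: 'a set" B] B by auto
  then have bB: "b j \<in> B" for j by (auto simp: bij_betw_def)
  then have "\<forall>j. \<exists>\<mu>. ?A *v b j = \<mu> *\<^sub>R b j" using eig by blast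
  then obtain l where l: "\<And>j. ?A *v b j = l j *\<^sub>R b j" 
    using choice[of "\<lambda>j \<mu>. ?A *v b j = \<mu> *\<^sub>R b j"] by blast
  define U where "U = (\<chi> i j. b j $ i)"
  have col: "column j U = b j" for j by (simp add: U_def column_def vec_eq_iff)
  have U: "orthogonal_matrix U"
    unfolding orthogonal_matrix_orthonormal_columns col
  proof (intro conjI allI impI)
    show "norm (b i) = 1" for i using eig bB by blast
    show "orthogonal (b i) (b j)" if "i \<noteq> j" for i j
      using bij_betw_imp_inj_on[OF b] that by (intro pairwiseD[OF B(3)] bB) (auto dest: injD)
  qed
  have "(?A ** U) $ i $ j = (U ** Diag (\<chi> j. l j)) $ i $ j" for i j
  proof -
    have "(?A ** U) $ i $ j = (?A *v b j) $ i"
      by (simp add: matrix_matrix_mult_def matrix_vector_mult_def U_def)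
    then show ?thesis by (simp add: l matrix_mult_Diag U_def mult.commute)
  qed
  then have "?A ** U = U ** Diag (\<chi> j. l j)" by (simp add: vec_eq_iff)
  then have "?A ** (U ** transpose U) = U ** Diag (\<chi> j. l j) ** transpose U"
    by (simp add: matrix_mul_assoc)
  then have "?A = U ** Diag (\<chi> j. l j) ** transpose U"
    using U by (simp add: orthogonal_matrix_def)
  with U show ?thesis by (auto simp: eigendecomposition_def)
qed

context
  fixes W :: "'d::finite sym_mat" and U l
  assumes W: "eigendecomposition W U l"
begin

lemma det_eigendecomposition: "det (mat_of_sym W) = (\<Prod>i\<in>UNIV. l $ i)"
proof -
  have "det U * det U = 1"
    using W det_orthogonal_matrix[of U] by (auto simp: eigendecomposition_def)
  then show ?thesis using W by (simp add: eigendecomposition_def det_mul det_Diag)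
qed

lemma trace_eigendecomposition: "trace (mat_of_sym W) = (\<Sum>i\<in>UNIV. l $ i)"
proof -
  have "trace (mat_of_sym W) = trace (transpose U ** (U ** Diag l))"
    using W unfolding eigendecomposition_def by (metis trace_mul_sym)
  also have "\<dots> = trace (Diag l)"
    using W by (simp add: eigendecomposition_def matrix_mul_assoc orthogonal_matrix_def)
  finally show ?thesis by (simp add: trace_Diag)
qed

text \<open>The eigenvalue is the value of the quadratic form at the corresponding column of \<open>U\<close>.\<close>

lemma eigenvalue_pos:
  assumes "pos_def W"
  shows "0 < l $ i"
proof -
  let ?u = "column i U"
  have U: "orthogonal_matrix U" using W by (simp add: eigendecomposition_def)
  have "mat_of_sym W ** U = U ** Diag l ** (transpose U ** U)"
    using W by (simp add: eigendecomposition_def matrix_mul_assoc)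
  then have WU: "mat_of_sym W ** U = U ** Diag l" using U by (simp add: orthogonal_matrix_def)
  have "(mat_of_sym W *v ?u) $ k = (mat_of_sym W ** U) $ k $ i" for k
    by (simp add: matrix_matrix_mult_def matrix_vector_mult_def column_def)
  then have "mat_of_sym W *v ?u = l $ i *\<^sub>R ?u"
    by (simp add: WU vec_eq_iff matrix_mult_Diag column_def mult.commute)
  moreover have u: "?u \<bullet> ?u = 1"
    using U by (simp add: orthogonal_matrix_orthonormal_columns norm_eq_1)
  moreover have "?u \<noteq> 0" using u by force
  ultimately show ?thesis using assms by (force simp: pos_def_def)
qed

lemma det_pos_def_pos: "pos_def W \<Longrightarrow> 0 < det (mat_of_sym W)"
  by (simp add: det_eigendecomposition eigenvalue_pos prod_pos)

lemma ln_det_eigendecomposition: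
  "pos_def W \<Longrightarrow> ln (det (mat_of_sym W)) = (\<Sum>i\<in>UNIV. ln (l $ i))"
proof -
  assume "pos_def W"
  then have "l $ i \<noteq> 0" for i using eigenvalue_pos[of i] by simp
  then show ?thesis unfolding det_eigendecomposition by (intro ln_prod) simp_all
qed

end


section \<open>The log-determinant on the positive definite matrices\<close>

lemma pos_def_det_pos: "pos_def W \<Longrightarrow> 0 < det (mat_of_sym W)"
  using eigendecomposition_exists det_pos_def_pos by blast

lemma eigendecomposition_eigenvalues: "\<exists>U. eigendecomposition W U (eigenvalues W)"
proof -
  have "\<exists>l U. eigendecomposition W U l" using eigendecomposition_exists by blast
  then show ?thesis unfolding eigenvalues_def by (rule someI_ex)
qed

lemma sum_log_eigenvalues: "pos_def W \<Longrightarrow> sum_log (eigenvalues W) = ln (det (mat_of_sym W))"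
proof -
  assume W: "pos_def W"
  obtain U where "eigendecomposition W U (eigenvalues W)" using eigendecomposition_eigenvalues by blast
  from ln_det_eigendecomposition[OF this W] show ?thesis by (simp add: sum_log_def)
qed

text \<open>Testing against \<open>outer x\<close> turns the quadratic form of \<open>W\<close> at \<open>x\<close> into the trace inner
  product \<open>W \<bullet> outer x\<close>, so positive definiteness becomes a family of linear inequalities in \<open>W\<close>.\<close>

definition outer :: "real^'d \<Rightarrow> 'd::finite sym_mat"
  where "outer x = sym_of_mat (\<chi> i j. x $ i * x $ j)"

lemma mat_of_sym_outer: "mat_of_sym (outer x) = (\<chi> i j. x $ i * x $ j)"
  unfolding outer_def by (rule sym_of_mat_inverse) (simp add: transpose_def vec_eq_iff mult.commute)

lemma inner_outer: "W \<bullet> outer x = x \<bullet> (mat_of_sym W *v x)"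
  by (simp add: inner_mat_of_sym mat_of_sym_outer inner_vec_def matrix_vector_mult_def
      sum_distrib_left mult_ac)

lemma pos_def_outer: "pos_def W \<longleftrightarrow> (\<forall>x. x \<noteq> 0 \<longrightarrow> 0 < W \<bullet> outer x)"
  by (simp add: pos_def_def inner_outer)

lemma inner_outer_outer: "outer y \<bullet> outer x = (x \<bullet> y)\<^sup>2"
proof -
  have "mat_of_sym (outer y) *v x = (x \<bullet> y) *\<^sub>R y"
    by (simp add: mat_of_sym_outer matrix_vector_mult_def vec_eq_iff inner_vec_def sum_distrib_left mult_ac)
  then show ?thesis by (simp add: inner_outer power2_eq_square)
qed

lemma norm_outer: "norm (outer x) = x \<bullet> x"
  by (simp add: norm_eq_sqrt_inner inner_outer_outer)

definition id_sym :: "'d::finite sym_mat"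
  where "id_sym = sym_of_mat (mat 1)"

lemma mat_of_sym_id_sym: "mat_of_sym id_sym = mat 1"
  unfolding id_sym_def by (rule sym_of_mat_inverse) (simp add: transpose_mat)

lemma inner_id_sym_outer: "id_sym \<bullet> outer x = x \<bullet> x"
  by (simp add: inner_outer mat_of_sym_id_sym)

lemma outer_scaleR: "outer (c *\<^sub>R x) = c\<^sup>2 *\<^sub>R outer x"
  by (rule mat_of_sym_inject[THEN iffD1])
    (simp add: mat_of_sym_outer scaleR_sym_mat.rep_eq vec_eq_iff power2_eq_square mult_ac)

lemma pos_def_scaleR: "\<lbrakk>pos_def W; 0 < c\<rbrakk> \<Longrightarrow> pos_def (c *\<^sub>R W)"
  by (simp add: pos_def_outer)

lemma convex_pos_def: "convex {W. pos_def W}"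
proof -
  have "convex (\<Inter>x\<in>-{0}. {W. outer x \<bullet> W > 0})"
    by (intro convex_INT convex_halfspace_gt)
  also have "(\<Inter>x\<in>-{0}. {W. outer x \<bullet> W > 0}) = {W. pos_def W}"
    by (auto simp: pos_def_outer inner_commute)
  finally show ?thesis .
qed

text \<open>The minimum \<open>m\<close> of the quadratic form over the unit sphere is the radius of a ball of
  positive definite matrices around \<open>W\<close>, because \<open>norm (outer y) = y \<bullet> y\<close>.\<close>

lemma open_pos_def: "open {W :: 'd::finite sym_mat. pos_def W}"
  unfolding open_contains_ball
proof (intro ballI)
  fix W :: "'d sym_mat" assume "W \<in> {W. pos_def W}"
  then have W: "pos_def W" by simp
  have "sphere (0 :: real^'d) 1 \<noteq> {}" by simp
  moreover have "continuous_on (sphere 0 1) (\<lambda>x. W \<bullet> outer x)"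
    unfolding inner_outer by (intro continuous_intros matrix_vector_mult_linear_continuous_on)
  ultimately obtain x where x: "x \<in> sphere 0 1" "\<And>y. y \<in> sphere 0 1 \<Longrightarrow> W \<bullet> outer x \<le> W \<bullet> outer y"
    using continuous_attains_inf[OF compact_sphere, of 0 1 "\<lambda>x. W \<bullet> outer x"] by blast
  define m where "m = W \<bullet> outer x"
  have "x \<noteq> 0" using x by auto
  then have m: "0 < m" using W by (simp add: m_def pos_def_outer)
  have "ball W m \<subseteq> {W. pos_def W}"
  proof
    fix V assume V: "V \<in> ball W m"
    have "0 < V \<bullet> outer y" if y: "y \<noteq> 0" for y
    proof -
      have yy: "0 < y \<bullet> y" using y by simp
      have y_eq: "y = norm y *\<^sub>R ((1 / norm y) *\<^sub>R y)" using y by simp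
      have "m \<le> W \<bullet> outer ((1 / norm y) *\<^sub>R y)"
        unfolding m_def using y by (intro x(2)) simp
      then have "(norm y)\<^sup>2 * m \<le> (norm y)\<^sup>2 * (W \<bullet> outer ((1 / norm y) *\<^sub>R y))"
        by (intro mult_left_mono) auto
      also have "\<dots> = W \<bullet> outer y" by (subst (3) y_eq) (simp only: outer_scaleR inner_scaleR_right)
      finally have 1: "m * (y \<bullet> y) \<le> W \<bullet> outer y" by (simp add: power2_norm_eq_inner mult.commute)
      have "(W - V) \<bullet> outer y \<le> norm (W - V) * norm (outer y)" by (rule norm_cauchy_schwarz)
      also have "\<dots> < m * (y \<bullet> y)"
        using V yy by (simp add: norm_outer dist_norm)
      finally show ?thesis using 1 by (simp add: inner_diff_left)
    qed
    then show "V \<in> {W. pos_def W}" by (simp add: pos_def_outer)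
  qed
  with m show "\<exists>e>0. ball W e \<subseteq> {W. pos_def W}" by blast
qed

lemma pos_def_id_sym: "pos_def id_sym"
  by (simp add: pos_def_outer inner_id_sym_outer)

text \<open>The matrices \<open>outer x\<close> are limits of positive definite ones, so \<open>S\<close> is positive
  semidefinite.\<close>

lemma pos_def_dual:
  assumes dual: "\<And>W. pos_def W \<Longrightarrow> 0 \<le> W \<bullet> S" and E: "pos_def E"
  shows "pos_def (S + E)"
proof -
  have "0 \<le> S \<bullet> outer x" for x
  proof (rule nonneg_if_perturbations_nonneg)
    fix t :: real assume t: "0 < t"
    have "pos_def (outer x + t *\<^sub>R id_sym)"
      using t by (simp add: pos_def_outer inner_outer_outer inner_id_sym_outer inner_add_left add_nonneg_pos)
    from dual[OF this] show "0 \<le> S \<bullet> outer x + t * (id_sym \<bullet> S)"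
      by (simp add: inner_add_left inner_commute[of S])
  qed
  with E show ?thesis by (simp add: pos_def_outer inner_add_left add_nonneg_pos)
qed

text \<open>Write \<open>S = C C\<^sup>T\<close>. The matrix \<open>M = C\<^sup>T W C\<close> is positive definite, its determinant is
  \<open>det W * det S\<close> and its trace is \<open>W \<bullet> S\<close>, so the claim is \<open>ln x \<le> x - 1\<close> summed over the
  eigenvalues of \<open>M\<close>.\<close>

lemma ln_det_fenchel:
  fixes W S :: "'d::finite sym_mat"
  assumes W: "pos_def W" and S: "pos_def S"
  shows "ln (det (mat_of_sym W)) + ln (det (mat_of_sym S)) \<le> W \<bullet> S - real CARD('d)"
proof -
  obtain U l where Ul: "eigendecomposition S U l" using eigendecomposition_exists by blast
  define C where "C = U ** Diag (\<chi> i. sqrt (l $ i))"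
  have CC: "C ** transpose C = mat_of_sym S"
  proof -
    have "C ** transpose C = U ** (Diag (\<chi> i. sqrt (l $ i)) ** Diag (\<chi> i. sqrt (l $ i))) ** transpose U"
      by (simp add: C_def matrix_transpose_mul transpose_Diag matrix_mul_assoc)
    then show ?thesis
      using Ul eigenvalue_pos[OF Ul S, THEN less_imp_le] by (simp add: Diag_mult_Diag eigendecomposition_def)
  qed
  have C0: "det C \<noteq> 0"
    using pos_def_det_pos[OF S] by (auto simp: CC[symmetric] det_mul)
  define M where "M = sym_of_mat (transpose C ** mat_of_sym W ** C)"
  have M: "mat_of_sym M = transpose C ** mat_of_sym W ** C"
    unfolding M_def
    by (rule sym_of_mat_inverse) (simp add: matrix_transpose_mul transpose_mat_of_sym matrix_mul_assoc)
  have Mp: "pos_def M"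
    unfolding pos_def_def
  proof (intro allI impI)
    fix x :: "real^'d" assume x: "x \<noteq> 0"
    have "inj ((*v) C)" using C0 by (simp add: inj_matrix_vector_mult invertible_det_nz)
    then have "C *v x \<noteq> 0" using x by (metis injD matrix_vector_mult_0_right)
    then have "0 < (C *v x) \<bullet> (mat_of_sym W *v (C *v x))" using W by (simp add: pos_def_def)
    also have "\<dots> = x \<bullet> (transpose C *v (mat_of_sym W *v (C *v x)))"
      by (metis dot_lmul_matrix inner_commute transpose_matrix_vector)
    also have "\<dots> = x \<bullet> (mat_of_sym M *v x)"
      by (simp add: M matrix_vector_mul_assoc matrix_mul_assoc)
    finally show "0 < x \<bullet> (mat_of_sym M *v x)" .
  qed
  obtain V m where Vm: "eigendecomposition M V m" using eigendecomposition_exists by blast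
  have "ln (det (mat_of_sym W)) + ln (det (mat_of_sym S)) = ln (det (mat_of_sym W) * det (mat_of_sym S))"
    by (rule ln_mult_pos[symmetric]) (rule pos_def_det_pos[OF W] pos_def_det_pos[OF S])+
  also have "det (mat_of_sym W) * det (mat_of_sym S) = det (mat_of_sym M)"
    by (simp add: M CC[symmetric] det_mul)
  also have "ln \<dots> = (\<Sum>i\<in>UNIV. ln (m $ i))" by (rule ln_det_eigendecomposition[OF Vm Mp])
  also have "\<dots> \<le> (\<Sum>i\<in>UNIV. m $ i - 1)"
    by (intro sum_mono ln_le_minus_one eigenvalue_pos[OF Vm Mp])
  also have "\<dots> = trace (mat_of_sym M) - real CARD('d)"
    by (simp add: trace_eigendecomposition[OF Vm] sum_subtractf)
  also have "trace (mat_of_sym M) = trace (mat_of_sym W ** C ** transpose C)"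
    by (simp add: M matrix_mul_assoc[symmetric] trace_mul_sym[of "transpose C"])
  also have "\<dots> = W \<bullet> S"
    by (simp add: inner_sym_mat.rep_eq matrix_mul_assoc[symmetric] CC)
  finally show ?thesis .
qed

lemma matrix_inv_eqI:
  fixes A :: "real^'n^'n"
  assumes "A ** B = mat 1"
  shows "matrix_inv A = B"
proof -
  have BA: "B ** A = mat 1" using assms by (simp add: matrix_left_right_inverse)
  have "A ** matrix_inv A = mat 1 \<and> matrix_inv A ** A = mat 1"
    unfolding matrix_inv_def by (rule someI[of _ B]) (simp add: assms BA)
  then have "matrix_inv A = (B ** A) ** matrix_inv A" "A ** matrix_inv A = mat 1" by (auto simp: BA)
  then show ?thesis by (metis matrix_mul_assoc matrix_mul_rid)
qed

lemma matrix_inv_det_nz: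
  fixes A :: "real^'n^'n"
  assumes "det A \<noteq> 0"
  shows "A ** matrix_inv A = mat 1" "matrix_inv A ** A = mat 1"
proof -
  obtain B where "A ** B = mat 1" "B ** A = mat 1"
    using assms invertible_det_nz[of A] by (auto simp: invertible_def)
  then show "A ** matrix_inv A = mat 1" "matrix_inv A ** A = mat 1"
    using matrix_inv_eqI[of A B] by simp_all
qed

definition inv_sym :: "'d::finite sym_mat \<Rightarrow> 'd sym_mat"
  where "inv_sym W = sym_of_mat (matrix_inv (mat_of_sym W))"

lemma mat_of_sym_inv_sym:
  assumes "pos_def W"
  shows "mat_of_sym (inv_sym W) = matrix_inv (mat_of_sym W)"
  unfolding inv_sym_def
proof (rule sym_of_mat_inverse, rule CollectI)
  let ?A = "mat_of_sym W"
  have "transpose (matrix_inv ?A ** ?A) = mat 1"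
    using pos_def_det_pos[OF assms] by (simp add: matrix_inv_det_nz transpose_mat)
  then have "?A ** transpose (matrix_inv ?A) = mat 1"
    by (simp add: matrix_transpose_mul transpose_mat_of_sym)
  then show "transpose (matrix_inv ?A) = matrix_inv ?A" by (rule matrix_inv_eqI[symmetric])
qed

lemma mat_of_sym_mult_inv_sym:
  assumes "pos_def W"
  shows "mat_of_sym W ** mat_of_sym (inv_sym W) = mat 1"
  unfolding mat_of_sym_inv_sym[OF assms]
  using pos_def_det_pos[OF assms] by (intro matrix_inv_det_nz) simp

lemma pos_def_inv_sym:
  assumes "pos_def W"
  shows "pos_def (inv_sym W)"
  unfolding pos_def_def
proof (intro allI impI)
  fix x :: "real^'a" assume x: "x \<noteq> 0"
  define y where "y = mat_of_sym (inv_sym W) *v x"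
  have x_eq: "x = mat_of_sym W *v y"
    by (simp add: y_def matrix_vector_mul_assoc mat_of_sym_mult_inv_sym assms)
  then have "y \<noteq> 0" using x by auto
  then have "0 < y \<bullet> (mat_of_sym W *v y)" using assms by (simp add: pos_def_def)
  then show "0 < x \<bullet> (mat_of_sym (inv_sym W) *v x)"
    by (simp add: y_def[symmetric] x_eq[symmetric] inner_commute)
qed

lemma det_inv_sym:
  assumes "pos_def W"
  shows "ln (det (mat_of_sym (inv_sym W))) = - ln (det (mat_of_sym W))"
proof -
  have "det (mat_of_sym W) * det (mat_of_sym (inv_sym W)) = 1"
    using mat_of_sym_mult_inv_sym[OF assms] by (metis det_mul det_I)
  then have "det (mat_of_sym (inv_sym W)) = inverse (det (mat_of_sym W))"
    by (simp add: inverse_unique)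
  then show ?thesis using pos_def_det_pos[OF assms] by (simp add: ln_inverse)
qed

lemma inner_inv_sym:
  fixes W :: "'d::finite sym_mat"
  assumes "pos_def W"
  shows "W \<bullet> inv_sym W = real CARD('d)"
  by (simp add: inner_sym_mat.rep_eq mat_of_sym_mult_inv_sym[OF assms] trace_I)

lemma continuous_on_mat_of_sym [continuous_intros]:
  fixes f :: "'a::topological_space \<Rightarrow> 'd::finite sym_mat"
  assumes "continuous_on A f"
  shows "continuous_on A (\<lambda>x. mat_of_sym (f x))"
proof -
  have "linear (mat_of_sym :: 'd sym_mat \<Rightarrow> _)"
    by (rule linearI) (simp_all add: plus_sym_mat.rep_eq scaleR_sym_mat.rep_eq)
  then show ?thesis using assms by (simp add: linear_conv_bounded_linear bounded_linear.continuous_on)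
qed

lemma continuous_on_det [continuous_intros]:
  fixes f :: "'a::topological_space \<Rightarrow> real^'n^'n"
  assumes "\<And>i j. continuous_on A (\<lambda>x. f x $ i $ j)"
  shows "continuous_on A (\<lambda>x. det (f x))"
  unfolding det_def by (intro continuous_on_sum continuous_on_mult continuous_on_const continuous_on_prod assms)

lemma continuous_on_ln_det: "continuous_on {W. pos_def W} (\<lambda>W. ln (det (mat_of_sym W)))"
  by (intro continuous_intros) (auto dest: pos_def_det_pos)

text \<open>Cramer's rule expresses the inverse through determinants, which are polynomials in the
  entries. Continuity of matrix inversion follows.\<close>

lemma matrix_inv_cramer:
  fixes A :: "real^'n^'n"
  assumes "det A \<noteq> 0"
  shows "matrix_inv A $ k $ j = det (\<chi> i l. if l = k then axis j 1 $ i else A $ i $ l) / det A"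
proof -
  have "A *v column j (matrix_inv A) = axis j 1"
    using assms by (simp add: matrix_vector_mult_basis[symmetric] matrix_vector_mul_assoc matrix_inv_det_nz)
  then have "column j (matrix_inv A) $ k = det (\<chi> i l. if l = k then axis j 1 $ i else A $ i $ l) / det A"
    unfolding cramer[OF assms] by simp
  then show ?thesis by (simp add: column_def)
qed

lemma continuous_on_inv_sym: "continuous_on {W :: 'd::finite sym_mat. pos_def W} inv_sym"
proof -
  let ?P = "{W :: 'd sym_mat. pos_def W}"
  have "continuous_on ?P (\<lambda>W. matrix_inv (mat_of_sym W) $ k $ j) \<longleftrightarrow>
      continuous_on ?P (\<lambda>W. det (\<chi> i l. if l = k then axis j 1 $ i else mat_of_sym W $ i $ l) / det (mat_of_sym W))" for j k
    by (intro continuous_on_cong refl matrix_inv_cramer) (auto dest: pos_def_det_pos)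
  moreover have "continuous_on ?P (\<lambda>W. det (\<chi> i l. if l = k then axis j 1 $ i else mat_of_sym W $ i $ l) / det (mat_of_sym W))" for j k
  proof (rule continuous_on_divide[OF continuous_on_det continuous_on_det])
    show "continuous_on ?P (\<lambda>W. (\<chi> i l. if l = k then axis j 1 $ i else mat_of_sym W $ i $ l) $ i $ l)" for i l
      by (cases "l = k") (auto intro!: continuous_intros)
  qed (auto dest: pos_def_det_pos intro!: continuous_intros)
  ultimately have "continuous_on ?P (\<lambda>W. \<chi> k j. matrix_inv (mat_of_sym W) $ k $ j)"
    by (intro continuous_on_vec_lambda) auto
  then have "continuous_on ?P (\<lambda>W. matrix_inv (mat_of_sym W))" by simp
  then have "continuous_on ?P (\<lambda>W. mat_of_sym (inv_sym W))"
    by (subst continuous_on_cong[OF refl]) (auto simp: mat_of_sym_inv_sym)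
  moreover have "dist A B = dist (mat_of_sym A) (mat_of_sym B)" for A B :: "'d sym_mat"
    by (simp add: dist_norm norm_eq_sqrt_inner inner_mat_of_sym minus_sym_mat.rep_eq)
  ultimately show ?thesis by (simp add: continuous_on_iff)
qed

lemma ln_det_scaleR:
  fixes W :: "'d::finite sym_mat"
  assumes "pos_def W" "0 < c"
  shows "ln (det (mat_of_sym (c *\<^sub>R W))) = ln (det (mat_of_sym W)) + real CARD('d) * ln c"
proof -
  have "mat_of_sym (c *\<^sub>R W) = matrix ((*\<^sub>R) c) ** mat_of_sym W"
    by (simp add: scaleR_sym_mat.rep_eq matrix_scaleR vec_eq_iff matrix_matrix_mult_def mat_def
      if_distrib[where f = "\<lambda>x. x * _"] cong: if_cong)
  then have "det (mat_of_sym (c *\<^sub>R W)) = c ^ CARD('d) * det (mat_of_sym W)"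
    by (simp add: det_mul del: matrix_scaleR)
  then show ?thesis using assms pos_def_det_pos[OF assms(1)] by (simp add: ln_mult_pos ln_realpow)
qed

lemma log_homogeneous_ln_det:
  "log_homogeneous {W :: 'd::finite sym_mat. pos_def W} (\<lambda>W. ln (det (mat_of_sym W))) inv_sym (real CARD('d))"
proof
  show "{W :: 'd sym_mat. pos_def W} \<noteq> {}" using pos_def_id_sym by blast
qed (auto simp: open_pos_def convex_pos_def pos_def_scaleR pos_def_dual ln_det_scaleR ln_det_fenchel
    pos_def_inv_sym det_inv_sym inner_inv_sym continuous_on_ln_det continuous_on_inv_sym)


section \<open>The conjugate gradients of the logarithm and log-determinant cones\<close>

interpretation log: log_homogeneous "pos_orthant :: (real^'d) set" sum_log inv_vec "real CARD('d)"
  by (rule log_homogeneous_sum_log)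

interpretation logdet: log_homogeneous "{W :: 'd::finite sym_mat. pos_def W}"
    "\<lambda>W. ln (det (mat_of_sym W))" inv_sym "real CARD('d)"
  by (rule log_homogeneous_ln_det)

lemma log_cone_eq: "log_cone = closure log.hypo"
  unfolding log_cone_def log.hypo_def by (simp add: pos_orthant_def)

lemma log_barrier_eq: "log_barrier = log.barrier"
  by (simp add: log_barrier_def log.barrier_def fun_eq_iff sum_log_def)

lemma logdet_cone_eq: "logdet_cone = closure logdet.hypo"
  by (simp add: logdet_cone_def logdet.hypo_def)

text \<open>The chosen ordering of the eigenvalues is immaterial: for positive definite \<open>W\<close> the sum of
  their logarithms is \<open>ln (det W)\<close>, and division by \<open>v\<close> changes both by the same amount.\<close>

lemma logdet_barrier_eq:
  assumes "x \<in> logdet.strict_hypo"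
  shows "logdet_barrier x = logdet.barrier x"
proof -
  obtain u v W where x: "x = (u, v, W)" by (cases x)
  have v: "0 < v" and W: "pos_def W" using assms by (auto simp: x logdet.strict_hypo_def)
  obtain U where "eigendecomposition W U (eigenvalues W)"
    using eigendecomposition_eigenvalues by blast
  then have l: "eigenvalues W \<in> pos_orthant"
    using eigenvalue_pos W by (auto simp: pos_orthant_def)
  have "sum_log (eigenvalues W /\<^sub>R v) = ln (det (mat_of_sym (W /\<^sub>R v)))"
    using log.phi_scale[OF l] logdet.phi_scale[of W] W v by (simp add: sum_log_eigenvalues)
  then show ?thesis
    using W by (simp add: x logdet_barrier_def log_barrier_eq log.barrier_def logdet.barrier_def sum_log_eigenvalues)
qed

lemma matrix_inv_eigendecomposition:
  assumes "eigendecomposition W U l" "\<And>i. l $ i \<noteq> 0"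
  shows "matrix_inv (mat_of_sym W) = U ** Diag (inv_vec l) ** transpose U"
proof (rule matrix_inv_eqI)
  have U: "U ** transpose U = mat 1" "transpose U ** U = mat 1"
    using assms(1) by (auto simp: eigendecomposition_def orthogonal_matrix_def)
  have "mat_of_sym W ** (U ** Diag (inv_vec l) ** transpose U)
      = U ** Diag l ** (transpose U ** U) ** Diag (inv_vec l) ** transpose U"
    using assms(1) by (simp add: eigendecomposition_def matrix_mul_assoc)
  also have "\<dots> = U ** (Diag l ** Diag (inv_vec l)) ** transpose U"
    by (simp add: U matrix_mul_assoc)
  also have "Diag l ** Diag (inv_vec l) = mat 1"
    using assms(2) by (simp add: Diag_mult_Diag inv_vec_def) (simp add: Diag_def mat_def vec_eq_iff)
  finally show "mat_of_sym W ** (U ** Diag (inv_vec l) ** transpose U) = mat 1"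
    by (simp add: U)
qed

lemma Diag_scaleR: "Diag (c *\<^sub>R l) = c *\<^sub>R Diag l"
  by (simp add: Diag_def vec_eq_iff)

theorem proposition3p2:
  fixes p q Om :: real
    and R :: "'d::finite sym_mat"
    and U\<^sub>R :: "real^'d^'d"
    and l\<^sub>R :: "real^'d"
    and Gp Gq gp gq :: real
    and GR :: "'d sym_mat"
    and gr :: "real^'d"
  assumes "(p, q, R) \<in> interior (dual_cone logdet_cone)"
    and "eigendecomposition R U\<^sub>R l\<^sub>R"
    and "Om = real CARD('d) *
           wright_omega ((1 / real CARD('d)) *
               (1 + real CARD('d) - q / p + (\<Sum>i\<in>UNIV. ln (- (l\<^sub>R $ i) / p)))
             - ln (real CARD('d)))"
    and "(Gp, Gq, GR) = conjugate_gradient logdet_cone logdet_barrier (p, q, R)"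
    and "(gp, gq, gr) = conjugate_gradient log_cone log_barrier (p, q, l\<^sub>R)"
  shows "conjugate_gradient_exists logdet_cone logdet_barrier (p, q, R) \<and>
    conjugate_gradient_exists log_cone log_barrier (p, q, l\<^sub>R) \<and>
    p \<noteq> 0 \<and> (\<forall>i. 0 < - (l\<^sub>R $ i) / p) \<and> Om \<noteq> 1 \<and> invertible (mat_of_sym R) \<and>
    Gp = gp \<and> gp = (- real CARD('d) - 2 + q / p + 2 * Om) / (p * (1 - Om)) \<and>
    Gq = gq \<and> gq = - (inverse p * inverse (1 - Om)) \<and>
    mat_of_sym GR = U\<^sub>R ** Diag gr ** transpose U\<^sub>R \<and>
    U\<^sub>R ** Diag gr ** transpose U\<^sub>R = (Om / (1 - Om)) *\<^sub>R matrix_inv (mat_of_sym R)"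
proof -
  let ?d = "real CARD('d)"
  have D: "(p, q, R) \<in> logdet.strict_dual"
    using assms(1) by (simp add: logdet_cone_eq logdet.interior_dual_cone)
  then have p: "p < 0" and R: "pos_def R" by (auto simp: logdet.strict_dual_def)
  have l: "0 < l\<^sub>R $ i" for i using eigenvalue_pos[OF assms(2) R] .
  then have l_pos: "l\<^sub>R \<in> pos_orthant" by (simp add: pos_orthant_def)
  have sum_log_l: "sum_log l\<^sub>R = ln (det (mat_of_sym R))"
    using ln_det_eigendecomposition[OF assms(2) R] by (simp add: sum_log_def)
  \<comment> \<open>This identity makes the \<open>\<Omega>\<close> of the two cones equal.\<close>
  have phi: "sum_log (l\<^sub>R /\<^sub>R (- p)) = ln (det (mat_of_sym (R /\<^sub>R (- p))))"
  proof -
    have "0 < inverse (- p)" using p by simp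
    then show ?thesis
      using log.phi_scale[OF l_pos] logdet.phi_scale[of R] R
      by (simp add: sum_log_l del: inverse_minus_eq)
  qed
  have d: "(p, q, l\<^sub>R) \<in> log.strict_dual"
    using D l_pos by (simp add: log.strict_dual_def logdet.strict_dual_def phi del: inverse_minus_eq scaleR_minus_left)
  have "sum_log (l\<^sub>R /\<^sub>R (- p)) = (\<Sum>i\<in>UNIV. ln (- (l\<^sub>R $ i) / p))"
    by (simp add: sum_log_def divide_inverse mult.commute)
  then have om: "log.\<Omega> (p, q, l\<^sub>R) = Om" "logdet.\<Omega> (p, q, R) = Om"
    by (simp_all only: log.\<Omega>_def logdet.\<Omega>_def case_prod_conv assms(3) phi[symmetric])
  have Om: "1 < Om" using log.Omega_gt_1[OF d] by (simp add: om)
  have "- ((?d + 2 - q / p - 2 * Om) / (p * (1 - Om))) = (- ?d - 2 + q / p + 2 * Om) / (p * (1 - Om))"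
    by (simp only: minus_divide_left) simp
  moreover have "- (Om / (Om - 1)) = Om / (1 - Om)"
    by (simp only: minus_divide_right) simp
  ultimately have max: "- log.maximizer (p, q, l\<^sub>R) = ((- ?d - 2 + q / p + 2 * Om) / (p * (1 - Om)),
      - (inverse p * inverse (1 - Om)), (Om / (1 - Om)) *\<^sub>R inv_vec l\<^sub>R)"
    "- logdet.maximizer (p, q, R) = ((- ?d - 2 + q / p + 2 * Om) / (p * (1 - Om)),
      - (inverse p * inverse (1 - Om)), (Om / (1 - Om)) *\<^sub>R inv_sym R)"
    unfolding log.maximizer_def logdet.maximizer_def Let_def case_prod_conv om
    by (simp_all only: uminus_Pair scaleR_minus_left[symmetric] divide_inverse inverse_mult_distrib mult_1)
  have g: "(gp, gq, gr) = - log.maximizer (p, q, l\<^sub>R)"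
    unfolding assms(5) log_cone_eq by (rule log.conjugate_gradient_eq) (simp_all add: d log_barrier_eq)
  have G: "(Gp, Gq, GR) = - logdet.maximizer (p, q, R)"
    unfolding assms(4) logdet_cone_eq by (rule logdet.conjugate_gradient_eq) (simp_all add: D logdet_barrier_eq)
  have ex: "conjugate_gradient_exists logdet_cone logdet_barrier (p, q, R)"
    unfolding logdet_cone_eq by (rule logdet.conjugate_gradient_exists) (simp_all add: D logdet_barrier_eq)
  have ex': "conjugate_gradient_exists log_cone log_barrier (p, q, l\<^sub>R)"
    unfolding log_cone_eq by (rule log.conjugate_gradient_exists) (simp_all add: d log_barrier_eq)
  have inv: "matrix_inv (mat_of_sym R) = U\<^sub>R ** Diag (inv_vec l\<^sub>R) ** transpose U\<^sub>R"
    using l by (intro matrix_inv_eigendecomposition assms(2)) (simp add: less_imp_neq[symmetric])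
  have Ugr: "U\<^sub>R ** Diag gr ** transpose U\<^sub>R = (Om / (1 - Om)) *\<^sub>R matrix_inv (mat_of_sym R)"
    using g by (simp add: max inv Diag_scaleR matrix_scalar_ac scalar_matrix_assoc[symmetric])
  have GR: "mat_of_sym GR = (Om / (1 - Om)) *\<^sub>R matrix_inv (mat_of_sym R)"
    using G by (simp add: max scaleR_sym_mat.rep_eq mat_of_sym_inv_sym R)
  show ?thesis
  proof (intro conjI allI)
    show "invertible (mat_of_sym R)" using pos_def_det_pos[OF R] by (simp add: invertible_det_nz)
    show "0 < - (l\<^sub>R $ i) / p" for i using l[of i] p by (simp add: divide_pos_neg)
  qed (use ex ex' p Om g G GR Ugr in \<open>simp_all add: max\<close>)
qed
end
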